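(* Let $(R,P)$ be a Rota-Baxter algebra of weight $\lambda$ over a unitary commutative ring $\mathbf{k}$. An $(R,P)$-module structure on an $R$-module $M$ is exactly a $U_{RB}(R)$-module structure on $M$ extending the $R$-module structure (with $Q\in U_{RB}(R)$ acting as $p$). More precisely, the category of $(R,P)$-modules is isomorphic to the category of $U_{RB}(R)$-modules.
   Context: Algebras are unitary associative over $\mathbf{k}$. A Rota-Baxter algebra of weight $\lambda\in\mathbf{k}$ is a pair $(R,P)$ with $R$ a $\mathbf{k}$-algebra and $P:R\to R$ $\mathbf{k}$-linear with $P(x)P(y)=P(xP(y))+P(P(x)y)+\lambda P(xy)$ for all $x,y\in R$. A (left) $(R,P)$-module is a pair $(M,p)$ with $M$ a left $R$-module and $p:M\to M$ $\mathbf{k}$-linear such that $P(a)p(x)=p(ap(x))+p(P(a)x)+\lambda p(ax)$ for all $a\in R$, $x\in M$; a homomorphism $(M,p_M)\to(N,p_N)$ is an $R$-module homomorphism $f$ with $f\circ p_M=p_N\circ f$. The ring of Rota-Baxter operators $U_{RB}(R)=U_{RB}(R,P)$ is the quotient of the free product (coproduct of unitary associative $\mathbf{k}$-algebras) $\mathbf{k}\langle R,\mathbf{k}[Q]\rangle$ of $R$ and the polynomial algebra $\mathbf{k}[Q]$ by the two-sided ideal generated by the elements $QrQ-P(r)Q+QP(r)+\lambda Qr$ for $r\in R$. A $U_{RB}(R)$-module is regarded as an $R$-module through the natural homomorphism $R\to U_{RB}(R)$. *)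

theory Defs
  imports "HOL-Algebra.QuotRing" "HOL-Algebra.UnivPoly" "HOL-Library.FuncSet"
begin

section \<open>Algebras and left modules\<close>

text \<open>The library locale \<open>algebra\<close> is restricted to commutative algebras, and \<open>module\<close> to modules
  over commutative rings; the two locales below are the versions without commutativity.
  As for \<open>module\<close>, the fields \<open>mult\<close> and \<open>one\<close> of a module record are irrelevant.\<close>

locale unital_algebra = module K A + ring A for K (structure) and A (structure) +
  assumes smult_mult_left:
      "\<lbrakk>c \<in> carrier K; x \<in> carrier A; y \<in> carrier A\<rbrakk> \<Longrightarrow>
        (c \<odot>\<^bsub>A\<^esub> x) \<otimes>\<^bsub>A\<^esub> y = c \<odot>\<^bsub>A\<^esub> (x \<otimes>\<^bsub>A\<^esub> y)"
    and smult_mult_right: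
      "\<lbrakk>c \<in> carrier K; x \<in> carrier A; y \<in> carrier A\<rbrakk> \<Longrightarrow>
        x \<otimes>\<^bsub>A\<^esub> (c \<odot>\<^bsub>A\<^esub> y) = c \<odot>\<^bsub>A\<^esub> (x \<otimes>\<^bsub>A\<^esub> y)"

locale left_module = R?: ring R + M?: abelian_group M for R (structure) and M (structure) +
  assumes smult_closed:
      "\<lbrakk>a \<in> carrier R; x \<in> carrier M\<rbrakk> \<Longrightarrow> a \<odot>\<^bsub>M\<^esub> x \<in> carrier M"
    and smult_l_distr:
      "\<lbrakk>a \<in> carrier R; b \<in> carrier R; x \<in> carrier M\<rbrakk> \<Longrightarrow>
        (a \<oplus> b) \<odot>\<^bsub>M\<^esub> x = a \<odot>\<^bsub>M\<^esub> x \<oplus>\<^bsub>M\<^esub> b \<odot>\<^bsub>M\<^esub> x"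
    and smult_r_distr:
      "\<lbrakk>a \<in> carrier R; x \<in> carrier M; y \<in> carrier M\<rbrakk> \<Longrightarrow>
        a \<odot>\<^bsub>M\<^esub> (x \<oplus>\<^bsub>M\<^esub> y) = a \<odot>\<^bsub>M\<^esub> x \<oplus>\<^bsub>M\<^esub> a \<odot>\<^bsub>M\<^esub> y"
    and smult_assoc:
      "\<lbrakk>a \<in> carrier R; b \<in> carrier R; x \<in> carrier M\<rbrakk> \<Longrightarrow>
        (a \<otimes> b) \<odot>\<^bsub>M\<^esub> x = a \<odot>\<^bsub>M\<^esub> (b \<odot>\<^bsub>M\<^esub> x)"
    and smult_one:
      "x \<in> carrier M \<Longrightarrow> \<one> \<odot>\<^bsub>M\<^esub> x = x"

definition module_homs ::
  "('a, 'r) ring_scheme \<Rightarrow> ('a, 'm, 's) module_scheme \<Rightarrow> ('a, 'n, 't) module_scheme \<Rightarrow> ('m \<Rightarrow> 'n) set" where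
  "module_homs A M N = {f \<in> carrier M \<rightarrow>\<^sub>E carrier N.
     (\<forall>x\<in>carrier M. \<forall>y\<in>carrier M. f (x \<oplus>\<^bsub>M\<^esub> y) = f x \<oplus>\<^bsub>N\<^esub> f y) \<and>
     (\<forall>a\<in>carrier A. \<forall>x\<in>carrier M. f (a \<odot>\<^bsub>M\<^esub> x) = a \<odot>\<^bsub>N\<^esub> f x)}"


section \<open>Rota-Baxter algebras and their modules\<close>

locale rota_baxter_algebra = unital_algebra K R for K (structure) and R (structure) +
  fixes P :: "'b \<Rightarrow> 'b" and lam :: 'a
  assumes weight: "lam \<in> carrier K"
    and P_closed: "x \<in> carrier R \<Longrightarrow> P x \<in> carrier R"
    and P_add: "\<lbrakk>x \<in> carrier R; y \<in> carrier R\<rbrakk> \<Longrightarrow> P (x \<oplus>\<^bsub>R\<^esub> y) = P x \<oplus>\<^bsub>R\<^esub> P y"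
    and P_smult: "\<lbrakk>c \<in> carrier K; x \<in> carrier R\<rbrakk> \<Longrightarrow> P (c \<odot>\<^bsub>R\<^esub> x) = c \<odot>\<^bsub>R\<^esub> P x"
    and rota_baxter: "\<lbrakk>x \<in> carrier R; y \<in> carrier R\<rbrakk> \<Longrightarrow>
      P x \<otimes>\<^bsub>R\<^esub> P y =
        P (x \<otimes>\<^bsub>R\<^esub> P y) \<oplus>\<^bsub>R\<^esub> P (P x \<otimes>\<^bsub>R\<^esub> y) \<oplus>\<^bsub>R\<^esub> lam \<odot>\<^bsub>R\<^esub> P (x \<otimes>\<^bsub>R\<^esub> y)"

text \<open>A module \<open>M\<close> over a \<open>K\<close>-algebra \<open>R\<close> is a \<open>K\<close>-module through \<open>c \<mapsto> c\<cdot>1\<^sub>R\<close>.\<close>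

definition base_smult ::
  "('k, 'r, 's) module_scheme \<Rightarrow> ('r, 'm, 't) module_scheme \<Rightarrow> 'k \<Rightarrow> 'm \<Rightarrow> 'm" where
  "base_smult R M c x = (c \<odot>\<^bsub>R\<^esub> \<one>\<^bsub>R\<^esub>) \<odot>\<^bsub>M\<^esub> x"

locale rota_baxter_module =
  RB?: rota_baxter_algebra K R P lam + LM?: left_module R M
  for K (structure) and R (structure) and P and lam and M (structure) +
  fixes p :: "'d \<Rightarrow> 'd"
  assumes p_closed: "x \<in> carrier M \<Longrightarrow> p x \<in> carrier M"
    and p_add: "\<lbrakk>x \<in> carrier M; y \<in> carrier M\<rbrakk> \<Longrightarrow> p (x \<oplus>\<^bsub>M\<^esub> y) = p x \<oplus>\<^bsub>M\<^esub> p y"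
    and p_smult: "\<lbrakk>c \<in> carrier K; x \<in> carrier M\<rbrakk> \<Longrightarrow>
      p (base_smult R M c x) = base_smult R M c (p x)"
    and rota_baxter_mod: "\<lbrakk>a \<in> carrier R; x \<in> carrier M\<rbrakk> \<Longrightarrow>
      P a \<odot>\<^bsub>M\<^esub> p x =
        p (a \<odot>\<^bsub>M\<^esub> p x) \<oplus>\<^bsub>M\<^esub> p (P a \<odot>\<^bsub>M\<^esub> x) \<oplus>\<^bsub>M\<^esub> base_smult R M lam (p (a \<odot>\<^bsub>M\<^esub> x))"


section \<open>Free algebras, quotient algebras and free products\<close>

text \<open>The free \<open>K\<close>-algebra on a set \<open>X\<close>, realised as the monoid algebra of the free monoid
  \<open>lists X\<close>: finitely supported coefficient functions with the convolution product.\<close>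

definition free_algebra :: "('k, 's) ring_scheme \<Rightarrow> 'x set \<Rightarrow> ('k, 'x list \<Rightarrow> 'k) module" where
  "free_algebra K X =
    \<lparr>carrier = {f. range f \<subseteq> carrier K \<and> finite {w. f w \<noteq> \<zero>\<^bsub>K\<^esub>} \<and> {w. f w \<noteq> \<zero>\<^bsub>K\<^esub>} \<subseteq> lists X},
     mult = (\<lambda>f g w. \<Oplus>\<^bsub>K\<^esub>i\<in>{..length w}. f (take i w) \<otimes>\<^bsub>K\<^esub> g (drop i w)),
     one = (\<lambda>w. if w = [] then \<one>\<^bsub>K\<^esub> else \<zero>\<^bsub>K\<^esub>),
     zero = (\<lambda>w. \<zero>\<^bsub>K\<^esub>),
     add = (\<lambda>f g w. f w \<oplus>\<^bsub>K\<^esub> g w),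
     smult = (\<lambda>c f w. c \<otimes>\<^bsub>K\<^esub> f w)\<rparr>"

definition free_gen :: "('k, 's) ring_scheme \<Rightarrow> 'x \<Rightarrow> 'x list \<Rightarrow> 'k" where
  "free_gen K x = (\<lambda>w. if w = [x] then \<one>\<^bsub>K\<^esub> else \<zero>\<^bsub>K\<^esub>)"

definition quot_algebra :: "('k, 'a, 's) module_scheme \<Rightarrow> 'a set \<Rightarrow> ('k, 'a set) module" where
  "quot_algebra A I =
    \<lparr>carrier = carrier (A Quot I), mult = mult (A Quot I), one = one (A Quot I),
     zero = zero (A Quot I), add = add (A Quot I),
     smult = (\<lambda>c X. \<Union>x\<in>X. I +>\<^bsub>A\<^esub> (c \<odot>\<^bsub>A\<^esub> x))\<rparr>"

text \<open>The elements of \<open>F\<close> whose vanishing makes \<open>j : A \<rightarrow> F\<close> a homomorphism of unital \<open>K\<close>-algebras.\<close>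

definition hom_relations ::
  "('k, 's) ring_scheme \<Rightarrow> ('k, 'a, 't) module_scheme \<Rightarrow> ('k, 'f, 'u) module_scheme \<Rightarrow> ('a \<Rightarrow> 'f) \<Rightarrow> 'f set" where
  "hom_relations K A F j =
     {j (a \<oplus>\<^bsub>A\<^esub> b) \<ominus>\<^bsub>F\<^esub> (j a \<oplus>\<^bsub>F\<^esub> j b) | a b. a \<in> carrier A \<and> b \<in> carrier A} \<union>
     {j (c \<odot>\<^bsub>A\<^esub> a) \<ominus>\<^bsub>F\<^esub> (c \<odot>\<^bsub>F\<^esub> j a) | c a. c \<in> carrier K \<and> a \<in> carrier A} \<union>
     {j (a \<otimes>\<^bsub>A\<^esub> b) \<ominus>\<^bsub>F\<^esub> (j a \<otimes>\<^bsub>F\<^esub> j b) | a b. a \<in> carrier A \<and> b \<in> carrier A} \<union>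
     {j \<one>\<^bsub>A\<^esub> \<ominus>\<^bsub>F\<^esub> \<one>\<^bsub>F\<^esub>}"

text \<open>The coproduct of the unital associative \<open>K\<close>-algebras \<open>A\<close> and \<open>B\<close>: the free algebra on the
  disjoint union of the underlying sets, modulo the relations making both canonical maps
  homomorphisms of unital \<open>K\<close>-algebras.\<close>

definition free_product_ideal ::
  "('k, 's) ring_scheme \<Rightarrow> ('k, 'a, 't) module_scheme \<Rightarrow> ('k, 'b, 'u) module_scheme \<Rightarrow>
    (('a + 'b) list \<Rightarrow> 'k) set" where
  "free_product_ideal K A B =
     (let F = free_algebra K (Sum_Type.Plus (carrier A) (carrier B)) in
      Idl\<^bsub>F\<^esub> (hom_relations K A F (\<lambda>a. free_gen K (Inl a)) \<union>
             hom_relations K B F (\<lambda>b. free_gen K (Inr b))))"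

definition free_product ::
  "('k, 's) ring_scheme \<Rightarrow> ('k, 'a, 't) module_scheme \<Rightarrow> ('k, 'b, 'u) module_scheme \<Rightarrow>
    ('k, (('a + 'b) list \<Rightarrow> 'k) set) module" where
  "free_product K A B =
     quot_algebra (free_algebra K (Sum_Type.Plus (carrier A) (carrier B))) (free_product_ideal K A B)"

definition free_product_inl ::
  "('k, 's) ring_scheme \<Rightarrow> ('k, 'a, 't) module_scheme \<Rightarrow> ('k, 'b, 'u) module_scheme \<Rightarrow>
    'a \<Rightarrow> (('a + 'b) list \<Rightarrow> 'k) set" where
  "free_product_inl K A B a =
     free_product_ideal K A B +>\<^bsub>free_algebra K (Sum_Type.Plus (carrier A) (carrier B))\<^esub> free_gen K (Inl a)"

definition free_product_inr ::
  "('k, 's) ring_scheme \<Rightarrow> ('k, 'a, 't) module_scheme \<Rightarrow> ('k, 'b, 'u) module_scheme \<Rightarrow>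
    'b \<Rightarrow> (('a + 'b) list \<Rightarrow> 'k) set" where
  "free_product_inr K A B b =
     free_product_ideal K A B +>\<^bsub>free_algebra K (Sum_Type.Plus (carrier A) (carrier B))\<^esub> free_gen K (Inr b)"


section \<open>The ring of Rota-Baxter operators\<close>

type_synonym ('k, 'r) free_RB = "(('r + (nat \<Rightarrow> 'k)) list \<Rightarrow> 'k) set"

definition free_RB ::
  "('k, 's) ring_scheme \<Rightarrow> ('k, 'r, 't) module_scheme \<Rightarrow> ('k, ('k, 'r) free_RB) module" where
  "free_RB K R = free_product K R (UP K)"

definition free_RB_of ::
  "('k, 's) ring_scheme \<Rightarrow> ('k, 'r, 't) module_scheme \<Rightarrow> 'r \<Rightarrow> ('k, 'r) free_RB" where
  "free_RB_of K R r = free_product_inl K R (UP K) r"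

definition free_RB_Q ::
  "('k, 's) ring_scheme \<Rightarrow> ('k, 'r, 't) module_scheme \<Rightarrow> ('k, 'r) free_RB" where
  "free_RB_Q K R = free_product_inr K R (UP K) (monom (UP K) \<one>\<^bsub>K\<^esub> 1)"

definition URB_ideal ::
  "('k, 's) ring_scheme \<Rightarrow> ('k, 'r, 't) module_scheme \<Rightarrow> ('r \<Rightarrow> 'r) \<Rightarrow> 'k \<Rightarrow> ('k, 'r) free_RB set" where
  "URB_ideal K R P lam =
     (let F = free_RB K R; \<iota> = free_RB_of K R; Q = free_RB_Q K R in
      Idl\<^bsub>F\<^esub> {(Q \<otimes>\<^bsub>F\<^esub> \<iota> r \<otimes>\<^bsub>F\<^esub> Q) \<ominus>\<^bsub>F\<^esub> (\<iota> (P r) \<otimes>\<^bsub>F\<^esub> Q) \<oplus>\<^bsub>F\<^esub> (Q \<otimes>\<^bsub>F\<^esub> \<iota> (P r))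
               \<oplus>\<^bsub>F\<^esub> (lam \<odot>\<^bsub>F\<^esub> (Q \<otimes>\<^bsub>F\<^esub> \<iota> r)) | r. r \<in> carrier R})"

definition URB ::
  "('k, 's) ring_scheme \<Rightarrow> ('k, 'r, 't) module_scheme \<Rightarrow> ('r \<Rightarrow> 'r) \<Rightarrow> 'k \<Rightarrow>
    ('k, ('k, 'r) free_RB set) module" where
  "URB K R P lam = quot_algebra (free_RB K R) (URB_ideal K R P lam)"

definition URB_of ::
  "('k, 's) ring_scheme \<Rightarrow> ('k, 'r, 't) module_scheme \<Rightarrow> ('r \<Rightarrow> 'r) \<Rightarrow> 'k \<Rightarrow>
    'r \<Rightarrow> ('k, 'r) free_RB set" where
  "URB_of K R P lam r = URB_ideal K R P lam +>\<^bsub>free_RB K R\<^esub> free_RB_of K R r"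

definition URB_Q ::
  "('k, 's) ring_scheme \<Rightarrow> ('k, 'r, 't) module_scheme \<Rightarrow> ('r \<Rightarrow> 'r) \<Rightarrow> 'k \<Rightarrow> ('k, 'r) free_RB set" where
  "URB_Q K R P lam = URB_ideal K R P lam +>\<^bsub>free_RB K R\<^esub> free_RB_Q K R"


section \<open>Categories and their isomorphisms\<close>

text \<open>Hom-sets are indexed by source and target and need not be disjoint.\<close>

record ('o, 'h) category_data =
  obj :: "'o set"
  arr :: "'o \<Rightarrow> 'o \<Rightarrow> 'h set"
  ident :: "'o \<Rightarrow> 'h"
  compos :: "'o \<Rightarrow> 'o \<Rightarrow> 'o \<Rightarrow> 'h \<Rightarrow> 'h \<Rightarrow> 'h" \<comment> \<open>\<open>compos C X Y Z g f\<close> is \<open>g \<circ> f\<close> for \<open>f : X \<rightarrow> Y\<close>, \<open>g : Y \<rightarrow> Z\<close>\<close>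

locale category =
  fixes C :: "('o, 'h) category_data"
  assumes ident_arr: "X \<in> obj C \<Longrightarrow> ident C X \<in> arr C X X"
    and comp_arr: "\<lbrakk>X \<in> obj C; Y \<in> obj C; Z \<in> obj C; f \<in> arr C X Y; g \<in> arr C Y Z\<rbrakk> \<Longrightarrow>
      compos C X Y Z g f \<in> arr C X Z"
    and comp_ident: "\<lbrakk>X \<in> obj C; Y \<in> obj C; f \<in> arr C X Y\<rbrakk> \<Longrightarrow> compos C X X Y f (ident C X) = f"
    and ident_comp: "\<lbrakk>X \<in> obj C; Y \<in> obj C; f \<in> arr C X Y\<rbrakk> \<Longrightarrow> compos C X Y Y (ident C Y) f = f"
    and comp_assoc: "\<lbrakk>W \<in> obj C; X \<in> obj C; Y \<in> obj C; Z \<in> obj C;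
        f \<in> arr C W X; g \<in> arr C X Y; h \<in> arr C Y Z\<rbrakk> \<Longrightarrow>
      compos C W X Z (compos C X Y Z h g) f = compos C W Y Z h (compos C W X Y g f)"

locale category_functor = dom: category C + cod: category D
  for C :: "('o, 'h) category_data" and D :: "('p, 'i) category_data" +
  fixes F\<^sub>o :: "'o \<Rightarrow> 'p" and F\<^sub>a :: "'o \<Rightarrow> 'o \<Rightarrow> 'h \<Rightarrow> 'i"
  assumes map_obj: "X \<in> obj C \<Longrightarrow> F\<^sub>o X \<in> obj D"
    and map_arr: "\<lbrakk>X \<in> obj C; Y \<in> obj C; f \<in> arr C X Y\<rbrakk> \<Longrightarrow> F\<^sub>a X Y f \<in> arr D (F\<^sub>o X) (F\<^sub>o Y)"
    and map_ident: "X \<in> obj C \<Longrightarrow> F\<^sub>a X X (ident C X) = ident D (F\<^sub>o X)"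
    and map_comp: "\<lbrakk>X \<in> obj C; Y \<in> obj C; Z \<in> obj C; f \<in> arr C X Y; g \<in> arr C Y Z\<rbrakk> \<Longrightarrow>
      F\<^sub>a X Z (compos C X Y Z g f) = compos D (F\<^sub>o X) (F\<^sub>o Y) (F\<^sub>o Z) (F\<^sub>a Y Z g) (F\<^sub>a X Y f)"

definition category_isomorphism ::
  "('o, 'h) category_data \<Rightarrow> ('p, 'i) category_data \<Rightarrow> ('o \<Rightarrow> 'p) \<Rightarrow> ('o \<Rightarrow> 'o \<Rightarrow> 'h \<Rightarrow> 'i) \<Rightarrow> bool" where
  "category_isomorphism C D F\<^sub>o F\<^sub>a \<longleftrightarrow> category_functor C D F\<^sub>o F\<^sub>a \<and>
     (\<exists>G\<^sub>o G\<^sub>a. category_functor D C G\<^sub>o G\<^sub>a \<and>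
        (\<forall>X\<in>obj C. G\<^sub>o (F\<^sub>o X) = X) \<and>
        (\<forall>Y\<in>obj D. F\<^sub>o (G\<^sub>o Y) = Y) \<and>
        (\<forall>X\<in>obj C. \<forall>Y\<in>obj C. \<forall>f\<in>arr C X Y. G\<^sub>a (F\<^sub>o X) (F\<^sub>o Y) (F\<^sub>a X Y f) = f) \<and>
        (\<forall>X\<in>obj D. \<forall>Y\<in>obj D. \<forall>g\<in>arr D X Y. F\<^sub>a (G\<^sub>o X) (G\<^sub>o Y) (G\<^sub>a X Y g) = g))"


section \<open>The categories of modules\<close>

text \<open>The abelian group of \<open>M\<close> with scalars \<open>S\<close> acting by \<open>act\<close>. The unused fields of the record are
  fixed and all operations are restricted to the carriers, so that two modules built in this
  way are equal as records iff they have the same elements, zero, addition and action.\<close>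

definition module_with ::
  "'s set \<Rightarrow> ('a, 'm, 't) module_scheme \<Rightarrow> ('s \<Rightarrow> 'm \<Rightarrow> 'm) \<Rightarrow> ('s, 'm) module" where
  "module_with S M act =
    \<lparr>carrier = carrier M, mult = undefined, one = undefined, zero = \<zero>\<^bsub>M\<^esub>,
     add = (\<lambda>x\<in>carrier M. \<lambda>y\<in>carrier M. x \<oplus>\<^bsub>M\<^esub> y),
     smult = (\<lambda>a\<in>S. \<lambda>x\<in>carrier M. act a x)\<rparr>"

definition module_objects :: "('a, 's) ring_scheme \<Rightarrow> ('a, 'm) module set" where
  "module_objects A = {M. left_module A M \<and> module_with (carrier A) M (smult M) = M}"

definition module_category :: "('a, 's) ring_scheme \<Rightarrow> (('a, 'm) module, 'm \<Rightarrow> 'm) category_data" where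
  "module_category A =
    \<lparr>obj = module_objects A,
     arr = module_homs A,
     ident = (\<lambda>M. \<lambda>x\<in>carrier M. x),
     compos = (\<lambda>L M N g f. compose (carrier L) g f)\<rparr>"

definition RB_module_category ::
  "('k, 's) ring_scheme \<Rightarrow> ('k, 'r, 't) module_scheme \<Rightarrow> ('r \<Rightarrow> 'r) \<Rightarrow> 'k \<Rightarrow>
    (('r, 'm) module \<times> ('m \<Rightarrow> 'm), 'm \<Rightarrow> 'm) category_data" where
  "RB_module_category K R P lam =
    \<lparr>obj = {(M, p). M \<in> module_objects R \<and> p \<in> extensional (carrier M) \<and>
              rota_baxter_module K R P lam M p},
     arr = (\<lambda>(M, p) (N, q). {f \<in> module_homs R M N. \<forall>x\<in>carrier M. f (p x) = q (f x)}),
     ident = (\<lambda>(M, p). \<lambda>x\<in>carrier M. x),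
     compos = (\<lambda>(L, _) _ _ g f. compose (carrier L) g f)\<rparr>"

text \<open>A \<open>URB\<close>-module \<open>N\<close> regarded as an \<open>R\<close>-module with operator given by the action of \<open>Q\<close>.\<close>

definition URB_restrict ::
  "('k, 's) ring_scheme \<Rightarrow> ('k, 'r, 't) module_scheme \<Rightarrow> ('r \<Rightarrow> 'r) \<Rightarrow> 'k \<Rightarrow>
    (('k, 'r) free_RB set, 'm) module \<Rightarrow> ('r, 'm) module \<times> ('m \<Rightarrow> 'm)" where
  "URB_restrict K R P lam N =
     (module_with (carrier R) N (\<lambda>r x. URB_of K R P lam r \<odot>\<^bsub>N\<^esub> x),
      \<lambda>x\<in>carrier N. URB_Q K R P lam \<odot>\<^bsub>N\<^esub> x)"


section \<open>Structures on a fixed module\<close>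

definition RB_structures ::
  "('k, 's) ring_scheme \<Rightarrow> ('k, 'r, 't) module_scheme \<Rightarrow> ('r \<Rightarrow> 'r) \<Rightarrow> 'k \<Rightarrow>
    ('r, 'm, 'u) module_scheme \<Rightarrow> ('m \<Rightarrow> 'm) set" where
  "RB_structures K R P lam M =
     {p \<in> carrier M \<rightarrow>\<^sub>E carrier M. rota_baxter_module K R P lam M p}"

definition URB_structures ::
  "('k, 's) ring_scheme \<Rightarrow> ('k, 'r, 't) module_scheme \<Rightarrow> ('r \<Rightarrow> 'r) \<Rightarrow> 'k \<Rightarrow>
    ('r, 'm, 'u) module_scheme \<Rightarrow> (('k, 'r) free_RB set \<Rightarrow> 'm \<Rightarrow> 'm) set" where
  "URB_structures K R P lam M =
     {act \<in> carrier (URB K R P lam) \<rightarrow>\<^sub>E carrier M \<rightarrow>\<^sub>E carrier M.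
        left_module (URB K R P lam) (module_with (carrier (URB K R P lam)) M act) \<and>
        (\<forall>r\<in>carrier R. \<forall>x\<in>carrier M. act (URB_of K R P lam r) x = r \<odot>\<^bsub>M\<^esub> x)}"

end

theory Submission
  imports Defs "HOL-Algebra.Subrings"
begin

text \<open>The ring of Rota-Baxter operators has the universal property of a presentation by generators
  and relations: an algebra homomorphism from it into \<open>E\<close> is the same as a homomorphism
  \<open>j : R \<rightarrow> E\<close> together with \<open>q \<in> E\<close> such that
  \<open>j (P r) q = q j(r) q + q j(P r) + lam q j(r)\<close>. For \<open>E\<close> the algebra of \<open>K\<close>-linear endomorphisms of a
  module \<open>M\<close> and \<open>j\<close> its \<open>R\<close>-action, this equation is the Rota-Baxter identity of \<open>q\<close>, so
  operators \<open>p\<close> on \<open>M\<close> extend to actions. Actions and homomorphisms are determined by what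
  happens on \<open>R\<close> and \<open>Q\<close>, since these generate the ring of Rota-Baxter operators.\<close>

section \<open>The free algebra\<close>

text \<open>Elements of \<open>URB\<close> are cosets of cosets of coefficient functions on words,
  so no argument inspects one. From the coproduct upwards each layer is used through two facts: a
  lifting lemma, which builds homomorphisms out of it from data on the generators, and an induction
  rule, by which a property that holds for the generators and is preserved by sums and products
  holds everywhere. The inductions have no case for scalars: scaling by \<open>c\<close> is
  multiplication by the image of \<open>c \<odot> \<one>\<close> from \<open>R\<close>. The
  categories are to be isomorphic, not just equivalent, so restriction and extension must cancel as
  equalities of records; the normal form \<open>module_with\<close> provides this. Arrows on both
  sides are extensional functions between the same carriers, and the two hom-sets turn out to be the
  same set, so both functors are the identity on arrows. On objects the inverse functor needs no new
  construction: it is the inverse of the bijection between the structures on a fixed module.\<close>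

definition free_monom :: "('k, 's) ring_scheme \<Rightarrow> 'k \<Rightarrow> 'x list \<Rightarrow> 'x list \<Rightarrow> 'k" where
  "free_monom K c w = (\<lambda>v. if v = w then c else \<zero>\<^bsub>K\<^esub>)"

lemma free_gen_eq_monom: "free_gen K x = free_monom K \<one>\<^bsub>K\<^esub> [x]"
  by (simp add: free_gen_def free_monom_def)

lemma free_one_eq_monom: "\<one>\<^bsub>free_algebra K X\<^esub> = free_monom K \<one>\<^bsub>K\<^esub> []"
  by (simp add: free_algebra_def free_monom_def)

lemma free_algebra_zero: "\<zero>\<^bsub>free_algebra K X\<^esub> = (\<lambda>w. \<zero>\<^bsub>K\<^esub>)"
  by (simp add: free_algebra_def)

lemma free_algebra_add: "f \<oplus>\<^bsub>free_algebra K X\<^esub> g = (\<lambda>w. f w \<oplus>\<^bsub>K\<^esub> g w)"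
  by (simp add: free_algebra_def)

lemma free_algebra_smult: "c \<odot>\<^bsub>free_algebra K X\<^esub> f = (\<lambda>w. c \<otimes>\<^bsub>K\<^esub> f w)"
  by (simp add: free_algebra_def)

lemma free_algebra_mult:
  "f \<otimes>\<^bsub>free_algebra K X\<^esub> g = (\<lambda>w. \<Oplus>\<^bsub>K\<^esub>i\<in>{..length w}. f (take i w) \<otimes>\<^bsub>K\<^esub> g (drop i w))"
  by (simp add: free_algebra_def)

lemma free_algebra_carrier:
  "f \<in> carrier (free_algebra K X) \<longleftrightarrow>
    (\<forall>w. f w \<in> carrier K) \<and> finite {w. f w \<noteq> \<zero>\<^bsub>K\<^esub>} \<and> {w. f w \<noteq> \<zero>\<^bsub>K\<^esub>} \<subseteq> lists X"
  by (auto simp: free_algebra_def)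

lemmas free_algebra_ops =
  free_one_eq_monom free_algebra_zero free_algebra_add free_algebra_smult free_algebra_mult

section \<open>Algebra laws for noncommutative polynomials\<close>

context cring
begin

lemma free_coeff_closed [simp]: "f \<in> carrier (free_algebra R X) \<Longrightarrow> f w \<in> carrier R"
  by (simp add: free_algebra_carrier)

lemma free_algebra_carrierI:
  assumes "\<And>w. f w \<in> carrier R" "{w. f w \<noteq> \<zero>} \<subseteq> S" "finite S" "S \<subseteq> lists X"
  shows "f \<in> carrier (free_algebra R X)"
  using assms finite_subset[of "{w. f w \<noteq> \<zero>}" S] by (auto simp: free_algebra_carrier)

lemma free_supp_finite: "f \<in> carrier (free_algebra R X) \<Longrightarrow> finite {w. f w \<noteq> \<zero>}"
  and free_supp_lists: "f \<in> carrier (free_algebra R X) \<Longrightarrow> {w. f w \<noteq> \<zero>} \<subseteq> lists X"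
  by (simp_all add: free_algebra_carrier)

lemma free_monom_closed:
  "\<lbrakk>c \<in> carrier R; w \<in> lists X\<rbrakk> \<Longrightarrow> free_monom R c w \<in> carrier (free_algebra R X)"
  by (rule free_algebra_carrierI[where S = "{w}"]) (auto simp: free_monom_def)

lemma free_algebra_zero_closed: "\<zero>\<^bsub>free_algebra R X\<^esub> \<in> carrier (free_algebra R X)"
  by (auto simp: free_algebra_carrier free_algebra_zero)

lemma free_algebra_add_closed:
  assumes "f \<in> carrier (free_algebra R X)" "g \<in> carrier (free_algebra R X)"
  shows "f \<oplus>\<^bsub>free_algebra R X\<^esub> g \<in> carrier (free_algebra R X)"
  by (rule free_algebra_carrierI[where S = "{w. f w \<noteq> \<zero>} \<union> {w. g w \<noteq> \<zero>}"])
    (use assms in \<open>auto simp: free_algebra_add free_supp_finite dest: free_supp_lists\<close>)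

lemma free_algebra_smult_closed:
  assumes "c \<in> carrier R" "f \<in> carrier (free_algebra R X)"
  shows "c \<odot>\<^bsub>free_algebra R X\<^esub> f \<in> carrier (free_algebra R X)"
  by (rule free_algebra_carrierI[where S = "{w. f w \<noteq> \<zero>}"])
    (use assms in \<open>auto simp: free_algebra_smult free_supp_finite dest: free_supp_lists\<close>)

text \<open>A nonzero coefficient at \<open>w\<close> needs a splitting of \<open>w\<close> into a
  word of the support of \<open>f\<close> followed by one of the support of \<open>g\<close>, and
  there are only finitely many such concatenations.\<close>

lemma free_algebra_mult_closed:
  assumes f: "f \<in> carrier (free_algebra R X)" and g: "g \<in> carrier (free_algebra R X)"
  shows "f \<otimes>\<^bsub>free_algebra R X\<^esub> g \<in> carrier (free_algebra R X)"
proof (rule free_algebra_carrierI[where S = "(\<lambda>(u, v). u @ v) ` ({w. f w \<noteq> \<zero>} \<times> {w. g w \<noteq> \<zero>})"])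
  show "(f \<otimes>\<^bsub>free_algebra R X\<^esub> g) w \<in> carrier R" for w
    using f g by (auto simp: free_algebra_mult intro!: finsum_closed)
  show "{w. (f \<otimes>\<^bsub>free_algebra R X\<^esub> g) w \<noteq> \<zero>} \<subseteq> (\<lambda>(u, v). u @ v) ` ({w. f w \<noteq> \<zero>} \<times> {w. g w \<noteq> \<zero>})"
  proof (rule subsetI, rule ccontr)
    fix w assume w: "w \<in> {w. (f \<otimes>\<^bsub>free_algebra R X\<^esub> g) w \<noteq> \<zero>}"
      "w \<notin> (\<lambda>(u, v). u @ v) ` ({w. f w \<noteq> \<zero>} \<times> {w. g w \<noteq> \<zero>})"
    have "f (take i w) \<otimes> g (drop i w) = \<zero>" for i
    proof -
      have "f (take i w) = \<zero> \<or> g (drop i w) = \<zero>"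
        using w(2) by (auto simp: image_iff) (metis append_take_drop_id)
      then show ?thesis using f g by auto
    qed
    then have "(f \<otimes>\<^bsub>free_algebra R X\<^esub> g) w = \<zero>"
      by (simp add: free_algebra_mult finsum_zero)
    with w(1) show False by simp
  qed
  show "finite ((\<lambda>(u, v). u @ v) ` ({w. f w \<noteq> \<zero>} \<times> {w. g w \<noteq> \<zero>}))"
    using f g by (simp add: free_supp_finite)
  show "(\<lambda>(u, v). u @ v) ` ({w. f w \<noteq> \<zero>} \<times> {w. g w \<noteq> \<zero>}) \<subseteq> lists X"
  proof (rule image_subsetI)
    fix z assume "z \<in> {w. f w \<noteq> \<zero>} \<times> {w. g w \<noteq> \<zero>}"
    then have "f (fst z) \<noteq> \<zero>" "g (snd z) \<noteq> \<zero>" by auto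
    then have "fst z \<in> lists X" "snd z \<in> lists X"
      using f g unfolding free_algebra_carrier by blast+
    then show "(case z of (u, v) \<Rightarrow> u @ v) \<in> lists X" by (simp add: split_beta)
  qed
qed

lemma free_algebra_abelian_group: "abelian_group (free_algebra R X)"
proof (rule abelian_groupI)
  fix f assume f: "f \<in> carrier (free_algebra R X)"
  \<comment> \<open>Negatives are the multiples by \<open>\<ominus> \<one>\<close>, so closure under
    scalars already gives membership.\<close>
  show "\<exists>g\<in>carrier (free_algebra R X). g \<oplus>\<^bsub>free_algebra R X\<^esub> f = \<zero>\<^bsub>free_algebra R X\<^esub>"
    by (rule bexI[OF _ free_algebra_smult_closed[OF a_inv_closed[OF one_closed] f]])
      (use f in \<open>auto simp: free_algebra_ops l_minus l_neg\<close>)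
qed (auto simp: free_algebra_add_closed free_algebra_zero_closed,
     auto simp: free_algebra_add free_algebra_zero a_ac)

lemma free_algebra_l_distr:
  assumes "f \<in> carrier (free_algebra R X)" "g \<in> carrier (free_algebra R X)" "h \<in> carrier (free_algebra R X)"
  shows "(f \<oplus>\<^bsub>free_algebra R X\<^esub> g) \<otimes>\<^bsub>free_algebra R X\<^esub> h =
    f \<otimes>\<^bsub>free_algebra R X\<^esub> h \<oplus>\<^bsub>free_algebra R X\<^esub> g \<otimes>\<^bsub>free_algebra R X\<^esub> h"
  using assms by (simp add: free_algebra_mult free_algebra_add l_distr finsum_addf Pi_def)

lemma free_algebra_r_distr:
  assumes "f \<in> carrier (free_algebra R X)" "g \<in> carrier (free_algebra R X)" "h \<in> carrier (free_algebra R X)"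
  shows "h \<otimes>\<^bsub>free_algebra R X\<^esub> (f \<oplus>\<^bsub>free_algebra R X\<^esub> g) =
    h \<otimes>\<^bsub>free_algebra R X\<^esub> f \<oplus>\<^bsub>free_algebra R X\<^esub> h \<otimes>\<^bsub>free_algebra R X\<^esub> g"
  using assms by (simp add: free_algebra_mult free_algebra_add r_distr finsum_addf Pi_def)

lemma free_algebra_smult_l:
  assumes "c \<in> carrier R" "f \<in> carrier (free_algebra R X)" "g \<in> carrier (free_algebra R X)"
  shows "(c \<odot>\<^bsub>free_algebra R X\<^esub> f) \<otimes>\<^bsub>free_algebra R X\<^esub> g = c \<odot>\<^bsub>free_algebra R X\<^esub> (f \<otimes>\<^bsub>free_algebra R X\<^esub> g)"
  using assms by (simp add: free_algebra_mult free_algebra_smult finsum_rdistr Pi_def m_assoc)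

lemma free_algebra_smult_r:
  assumes "c \<in> carrier R" "f \<in> carrier (free_algebra R X)" "g \<in> carrier (free_algebra R X)"
  shows "f \<otimes>\<^bsub>free_algebra R X\<^esub> (c \<odot>\<^bsub>free_algebra R X\<^esub> g) = c \<odot>\<^bsub>free_algebra R X\<^esub> (f \<otimes>\<^bsub>free_algebra R X\<^esub> g)"
  using assms by (simp add: free_algebra_mult free_algebra_smult finsum_rdistr Pi_def m_lcomm)

text \<open>In the convolution at \<open>w\<close> the only splitting that can contribute is the one
  at position \<open>length u\<close>, and it does so only for \<open>w = u @ v\<close>.\<close>

lemma free_monom_mult:
  assumes c: "c \<in> carrier R" and d: "d \<in> carrier R"
  shows "free_monom R c u \<otimes>\<^bsub>free_algebra R X\<^esub> free_monom R d v = free_monom R (c \<otimes> d) (u @ v)"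
proof
  fix w
  let ?s = "\<lambda>i. free_monom R c u (take i w) \<otimes> free_monom R d v (drop i w)"
  have "(\<Oplus>i\<in>{..length w}. ?s i) = free_monom R (c \<otimes> d) (u @ v) w"
  proof (cases "w = u @ v")
    case True
    have "(\<Oplus>i\<in>{..length w}. ?s i) = (\<Oplus>i\<in>{..length w}. if length u = i then c \<otimes> d else \<zero>)"
    proof (rule finsum_cong')
      show "?s i = (if length u = i then c \<otimes> d else \<zero>)" if "i \<in> {..length w}" for i
      proof (cases "length u = i")
        case True with \<open>w = u @ v\<close> show ?thesis by (auto simp: free_monom_def)
      next
        case False
        \<comment> \<open>Because \<open>i \<le> length w\<close>, the prefix
          \<open>take i w\<close> has length exactly \<open>i\<close>.\<close>
        with that have "take i w \<noteq> u" by auto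
        with False c d show ?thesis by (simp add: free_monom_def)
      qed
    qed (use c d in auto)
    also have "\<dots> = c \<otimes> d"
      using True c d by (simp add: finsum_singleton)
    finally show ?thesis using True by (simp add: free_monom_def)
  next
    case False
    have "?s i = \<zero>" for i
    proof -
      have "take i w \<noteq> u \<or> drop i w \<noteq> v" using False by (metis append_take_drop_id)
      then show ?thesis using c d by (auto simp: free_monom_def)
    qed
    with False show ?thesis by (simp add: finsum_zero free_monom_def)
  qed
  then show "(free_monom R c u \<otimes>\<^bsub>free_algebra R X\<^esub> free_monom R d v) w = free_monom R (c \<otimes> d) (u @ v) w"
    by (simp add: free_algebra_mult)
qed

text \<open>Removing one word from the support at a time writes an element as a finite sum of
  monomials. Multilinear identities thereby reduce to monomials, where convolution becomes
  concatenation of words.\<close>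

lemma free_algebra_induct [consumes 1, case_names zero add monom]:
  assumes f: "f \<in> carrier (free_algebra R X)"
    and zero: "P \<zero>\<^bsub>free_algebra R X\<^esub>"
    and add: "\<And>f g. \<lbrakk>f \<in> carrier (free_algebra R X); g \<in> carrier (free_algebra R X); P f; P g\<rbrakk> \<Longrightarrow>
      P (f \<oplus>\<^bsub>free_algebra R X\<^esub> g)"
    and monom: "\<And>c w. \<lbrakk>c \<in> carrier R; w \<in> lists X\<rbrakk> \<Longrightarrow> P (free_monom R c w)"
  shows "P f"
proof -
  have "P f" if "finite S" "f \<in> carrier (free_algebra R X)" "{w. f w \<noteq> \<zero>} \<subseteq> S" for S f
    using that
  proof (induction S arbitrary: f rule: finite_induct)
    case empty
    then have "f = \<zero>\<^bsub>free_algebra R X\<^esub>" by (auto simp: free_algebra_zero)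
    with zero show ?case by simp
  next
    case (insert u S)
    let ?g = "f(u := \<zero>)" and ?m = "free_monom R (f u) u"
    have g: "?g \<in> carrier (free_algebra R X)"
      by (rule free_algebra_carrierI[where S = "{w. f w \<noteq> \<zero>}"])
        (use insert.prems(1) in \<open>auto simp: free_supp_finite dest: free_supp_lists\<close>)
    have "P ?g" using insert.prems(2) by (intro insert.IH g) auto
    show ?case
    \<comment> \<open>\<open>S\<close> merely contains the support and need not lie in
      \<open>lists X\<close>; a nonzero coefficient is what guarantees that \<open>u\<close> is a
      word over \<open>X\<close>, as the monomial case demands.\<close>
    proof (cases "f u = \<zero>")
      case True
      then have "?g = f" by auto
      with \<open>P ?g\<close> show ?thesis by simp
    next
      case False
      then have u: "u \<in> lists X" using insert.prems(1) by (auto dest: free_supp_lists)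
      have "f = ?g \<oplus>\<^bsub>free_algebra R X\<^esub> ?m"
        using insert.prems(1) by (auto simp: free_algebra_add free_monom_def)
      moreover have "P (?g \<oplus>\<^bsub>free_algebra R X\<^esub> ?m)"
        using insert.prems(1) u \<open>P ?g\<close> g by (intro add monom free_monom_closed) auto
      ultimately show ?thesis by simp
    qed
  qed
  from this[OF free_supp_finite[OF f] f] show ?thesis by simp
qed

lemma free_algebra_zero_mult:
  "f \<in> carrier (free_algebra R X) \<Longrightarrow> \<zero>\<^bsub>free_algebra R X\<^esub> \<otimes>\<^bsub>free_algebra R X\<^esub> f = \<zero>\<^bsub>free_algebra R X\<^esub>"
  "f \<in> carrier (free_algebra R X) \<Longrightarrow> f \<otimes>\<^bsub>free_algebra R X\<^esub> \<zero>\<^bsub>free_algebra R X\<^esub> = \<zero>\<^bsub>free_algebra R X\<^esub>"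
  by (simp_all add: free_algebra_mult free_algebra_zero finsum_zero)

lemmas free_algebra_closed =
  free_algebra_add_closed free_algebra_mult_closed free_algebra_zero_closed free_monom_closed

lemma free_algebra_ring: "ring (free_algebra R X)" (is "ring ?F")
proof (rule ringI[OF free_algebra_abelian_group])
  \<comment> \<open>Both sides are additive in each argument, so one induction per argument leaves
    monomials, for which the claim is associativity of \<open>@\<close> and of the
    coefficients.\<close>
  have assoc: "(f \<otimes>\<^bsub>?F\<^esub> g) \<otimes>\<^bsub>?F\<^esub> h = f \<otimes>\<^bsub>?F\<^esub> (g \<otimes>\<^bsub>?F\<^esub> h)"
    if f: "f \<in> carrier ?F" and g: "g \<in> carrier ?F" and h: "h \<in> carrier ?F" for f g h
    using f
  proof (induction rule: free_algebra_induct)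
    case (monom c u)
    show ?case using g
    proof (induction rule: free_algebra_induct)
      case (monom d v)
      show ?case using h
        by (induction rule: free_algebra_induct)
          (use monom \<open>c \<in> carrier R\<close> \<open>u \<in> lists X\<close> in
            \<open>simp_all add: free_algebra_zero_mult free_algebra_r_distr free_algebra_closed free_monom_mult m_assoc\<close>)
    qed (use h monom in
        \<open>simp_all add: free_algebra_zero_mult free_algebra_l_distr free_algebra_r_distr free_algebra_closed\<close>)
  qed (use g h in \<open>simp_all add: free_algebra_zero_mult free_algebra_l_distr free_algebra_closed\<close>)
  have one: "\<one>\<^bsub>?F\<^esub> \<in> carrier ?F" by (simp add: free_one_eq_monom free_monom_closed)
  have l_one: "\<one>\<^bsub>?F\<^esub> \<otimes>\<^bsub>?F\<^esub> f = f" and r_one: "f \<otimes>\<^bsub>?F\<^esub> \<one>\<^bsub>?F\<^esub> = f" if "f \<in> carrier ?F" for f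
    using that
    by (induction rule: free_algebra_induct)
      (simp_all add: one free_algebra_zero_mult free_algebra_l_distr free_algebra_r_distr,
       simp_all add: free_one_eq_monom free_monom_mult)
  show "Group.monoid ?F"
    by (rule monoidI) (simp_all add: free_algebra_mult_closed one assoc l_one r_one)
qed (simp_all add: free_algebra_l_distr free_algebra_r_distr)

lemma free_algebra_unital_algebra: "unital_algebra R (free_algebra R X)"
proof -
  interpret F: ring "free_algebra R X" by (rule free_algebra_ring)
  have "Module.module R (free_algebra R X)"
    by (rule moduleI[OF is_cring F.is_abelian_group])
      (auto simp: free_algebra_smult_closed,
       auto simp: free_algebra_smult free_algebra_add l_distr r_distr m_assoc)
  then show ?thesis
    by (intro unital_algebra.intro unital_algebra_axioms.intro)
      (simp_all add: F.ring_axioms free_algebra_smult_l free_algebra_smult_r)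
qed

end

section \<open>Algebra homomorphisms\<close>

definition algebra_homs ::
  "('k, 's) ring_scheme \<Rightarrow> ('k, 'a, 't) module_scheme \<Rightarrow> ('k, 'b, 'u) module_scheme \<Rightarrow> ('a \<Rightarrow> 'b) set" where
  "algebra_homs K A B =
    {h \<in> ring_hom A B. \<forall>c\<in>carrier K. \<forall>a\<in>carrier A. h (c \<odot>\<^bsub>A\<^esub> a) = c \<odot>\<^bsub>B\<^esub> h a}"

lemma algebra_homsI:
  assumes "\<And>a. a \<in> carrier A \<Longrightarrow> h a \<in> carrier B"
    and "\<And>a b. \<lbrakk>a \<in> carrier A; b \<in> carrier A\<rbrakk> \<Longrightarrow> h (a \<otimes>\<^bsub>A\<^esub> b) = h a \<otimes>\<^bsub>B\<^esub> h b"
    and "\<And>a b. \<lbrakk>a \<in> carrier A; b \<in> carrier A\<rbrakk> \<Longrightarrow> h (a \<oplus>\<^bsub>A\<^esub> b) = h a \<oplus>\<^bsub>B\<^esub> h b"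
    and "h \<one>\<^bsub>A\<^esub> = \<one>\<^bsub>B\<^esub>"
    and "\<And>c a. \<lbrakk>c \<in> carrier K; a \<in> carrier A\<rbrakk> \<Longrightarrow> h (c \<odot>\<^bsub>A\<^esub> a) = c \<odot>\<^bsub>B\<^esub> h a"
  shows "h \<in> algebra_homs K A B"
  unfolding algebra_homs_def by (intro CollectI conjI ring_hom_memI ballI assms)

lemma
  assumes "h \<in> algebra_homs K A B"
  shows algebra_homs_ring_hom: "h \<in> ring_hom A B"
    and algebra_homs_closed: "a \<in> carrier A \<Longrightarrow> h a \<in> carrier B"
    and algebra_homs_mult: "\<lbrakk>a \<in> carrier A; b \<in> carrier A\<rbrakk> \<Longrightarrow> h (a \<otimes>\<^bsub>A\<^esub> b) = h a \<otimes>\<^bsub>B\<^esub> h b"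
    and algebra_homs_add: "\<lbrakk>a \<in> carrier A; b \<in> carrier A\<rbrakk> \<Longrightarrow> h (a \<oplus>\<^bsub>A\<^esub> b) = h a \<oplus>\<^bsub>B\<^esub> h b"
    and algebra_homs_one: "h \<one>\<^bsub>A\<^esub> = \<one>\<^bsub>B\<^esub>"
    and algebra_homs_smult: "\<lbrakk>c \<in> carrier K; a \<in> carrier A\<rbrakk> \<Longrightarrow> h (c \<odot>\<^bsub>A\<^esub> a) = c \<odot>\<^bsub>B\<^esub> h a"
  using assms
proof -
  show h: "h \<in> ring_hom A B" using assms by (simp add: algebra_homs_def)
  show "a \<in> carrier A \<Longrightarrow> h a \<in> carrier B" by (rule ring_hom_closed[OF h])
  show "\<lbrakk>a \<in> carrier A; b \<in> carrier A\<rbrakk> \<Longrightarrow> h (a \<otimes>\<^bsub>A\<^esub> b) = h a \<otimes>\<^bsub>B\<^esub> h b" by (rule ring_hom_mult[OF h])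
  show "\<lbrakk>a \<in> carrier A; b \<in> carrier A\<rbrakk> \<Longrightarrow> h (a \<oplus>\<^bsub>A\<^esub> b) = h a \<oplus>\<^bsub>B\<^esub> h b" by (rule ring_hom_add[OF h])
  show "h \<one>\<^bsub>A\<^esub> = \<one>\<^bsub>B\<^esub>" by (rule ring_hom_one[OF h])
  show "\<lbrakk>c \<in> carrier K; a \<in> carrier A\<rbrakk> \<Longrightarrow> h (c \<odot>\<^bsub>A\<^esub> a) = c \<odot>\<^bsub>B\<^esub> h a"
    using assms by (simp add: algebra_homs_def)
qed

lemma algebra_homs_ring_hom_ring:
  assumes "h \<in> algebra_homs K A B" "unital_algebra K A" "unital_algebra K B"
  shows "ring_hom_ring A B h"
  by (rule ring_hom_ringI2[OF _ _ algebra_homs_ring_hom]) (rule assms unital_algebra.axioms(2))+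

lemma
  assumes "h \<in> algebra_homs K A B" "unital_algebra K A" "unital_algebra K B"
  shows algebra_homs_zero: "h \<zero>\<^bsub>A\<^esub> = \<zero>\<^bsub>B\<^esub>"
    and algebra_homs_minus:
      "\<lbrakk>a \<in> carrier A; b \<in> carrier A\<rbrakk> \<Longrightarrow> h (a \<ominus>\<^bsub>A\<^esub> b) = h a \<ominus>\<^bsub>B\<^esub> h b"
proof -
  interpret ring_hom_ring A B h by (rule algebra_homs_ring_hom_ring[OF assms])
  show "h \<zero>\<^bsub>A\<^esub> = \<zero>\<^bsub>B\<^esub>" by simp
  show "h (a \<ominus>\<^bsub>A\<^esub> b) = h a \<ominus>\<^bsub>B\<^esub> h b" if "a \<in> carrier A" "b \<in> carrier A"
    using that by (simp add: a_minus_def)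
qed

lemma algebra_homs_comp:
  assumes "g \<in> algebra_homs K A B" "h \<in> algebra_homs K B C"
  shows "h \<circ> g \<in> algebra_homs K A C"
proof -
  note simps = algebra_homs_closed algebra_homs_mult algebra_homs_add algebra_homs_one algebra_homs_smult
  show ?thesis
    by (rule algebra_homsI) (simp_all add: simps[OF assms(1)] simps[OF assms(2)])
qed

section \<open>Evaluation of noncommutative polynomials in an algebra\<close>

context unital_algebra
begin

lemma smult_as_mult: "\<lbrakk>c \<in> carrier K; x \<in> carrier A\<rbrakk> \<Longrightarrow> c \<odot>\<^bsub>A\<^esub> x = (c \<odot>\<^bsub>A\<^esub> \<one>\<^bsub>A\<^esub>) \<otimes>\<^bsub>A\<^esub> x"
  by (simp add: smult_mult_left)

definition word_prod :: "('x \<Rightarrow> 'c) \<Rightarrow> 'x list \<Rightarrow> 'c" where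
  "word_prod \<phi> w = foldr (\<lambda>x e. \<phi> x \<otimes>\<^bsub>A\<^esub> e) w \<one>\<^bsub>A\<^esub>"

definition free_eval :: "('x \<Rightarrow> 'c) \<Rightarrow> ('x list \<Rightarrow> 'a) \<Rightarrow> 'c" where
  "free_eval \<phi> f = (\<Oplus>\<^bsub>A\<^esub>w\<in>{w. f w \<noteq> \<zero>}. f w \<odot>\<^bsub>A\<^esub> word_prod \<phi> w)"

lemma word_prod_closed:
  "\<lbrakk>\<phi> \<in> X \<rightarrow> carrier A; w \<in> lists X\<rbrakk> \<Longrightarrow> word_prod \<phi> w \<in> carrier A"
  by (induction w) (auto simp: word_prod_def)

lemma word_prod_append:
  assumes "\<phi> \<in> X \<rightarrow> carrier A" "u \<in> lists X" "v \<in> lists X"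
  shows "word_prod \<phi> (u @ v) = word_prod \<phi> u \<otimes>\<^bsub>A\<^esub> word_prod \<phi> v"
  using assms(2)
proof (induction u)
  case Nil
  show ?case using word_prod_closed[OF assms(1,3)] by (simp add: word_prod_def)
next
  case (Cons x u)
  then have "x \<in> X" "u \<in> lists X" by auto
  moreover have "word_prod \<phi> (x # w) = \<phi> x \<otimes>\<^bsub>A\<^esub> word_prod \<phi> w" for w
    by (simp add: word_prod_def)
  ultimately show ?case
    using Cons.IH word_prod_closed[OF assms(1)] assms by (auto simp: m_assoc Pi_def)
qed

text \<open>The supports of two elements and of their sum differ, so their evaluations can be
  compared only over a common finite set of words; the additional words contribute zero.\<close>

lemma free_eval_superset:
  assumes \<phi>: "\<phi> \<in> X \<rightarrow> carrier A" and f: "f \<in> carrier (free_algebra K X)"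
    and S: "finite S" "{w. f w \<noteq> \<zero>} \<subseteq> S" "S \<subseteq> lists X"
  shows "free_eval \<phi> f = (\<Oplus>\<^bsub>A\<^esub>w\<in>S. f w \<odot>\<^bsub>A\<^esub> word_prod \<phi> w)"
  unfolding free_eval_def
proof (rule add.finprod_mono_neutral_cong_left[OF S(1,2)])
  show "(\<lambda>w. f w \<odot>\<^bsub>A\<^esub> word_prod \<phi> w) \<in> S \<rightarrow> carrier A"
    using S(3) f word_prod_closed[OF \<phi>] by (simp add: Pi_def subset_iff)
  show "f w \<odot>\<^bsub>A\<^esub> word_prod \<phi> w = \<zero>\<^bsub>A\<^esub>" if "w \<in> S - {w. f w \<noteq> \<zero>}" for w
    using that S(3) word_prod_closed[OF \<phi>, of w] by (simp add: subset_iff)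
qed auto

lemma free_eval_monom:
  assumes \<phi>: "\<phi> \<in> X \<rightarrow> carrier A" and "c \<in> carrier K" "w \<in> lists X"
  shows "free_eval \<phi> (free_monom K c w) = c \<odot>\<^bsub>A\<^esub> word_prod \<phi> w"
proof -
  have "free_eval \<phi> (free_monom K c w) = (\<Oplus>\<^bsub>A\<^esub>v\<in>{w}. free_monom K c w v \<odot>\<^bsub>A\<^esub> word_prod \<phi> v)"
    using assms by (intro free_eval_superset[OF \<phi> free_monom_closed]) (auto simp: free_monom_def)
  also have "\<dots> = c \<odot>\<^bsub>A\<^esub> word_prod \<phi> w"
    using assms word_prod_closed[OF assms(1,3)] by (simp add: free_monom_def)
  finally show ?thesis .
qed

lemma free_eval_gen:
  assumes "\<phi> \<in> X \<rightarrow> carrier A" "x \<in> X"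
  shows "free_eval \<phi> (free_gen K x) = \<phi> x"
  using assms by (simp add: free_gen_eq_monom free_eval_monom) (simp add: word_prod_def Pi_def)

lemma free_eval_closed:
  assumes \<phi>: "\<phi> \<in> X \<rightarrow> carrier A" and f: "f \<in> carrier (free_algebra K X)"
  shows "free_eval \<phi> f \<in> carrier A"
  unfolding free_eval_def
  using f word_prod_closed[OF \<phi>] free_supp_lists[OF f]
  by (intro finsum_closed) (simp add: Pi_def subset_iff)

lemma free_eval_add:
  assumes \<phi>: "\<phi> \<in> X \<rightarrow> carrier A"
    and f: "f \<in> carrier (free_algebra K X)" and g: "g \<in> carrier (free_algebra K X)"
  shows "free_eval \<phi> (f \<oplus>\<^bsub>free_algebra K X\<^esub> g) = free_eval \<phi> f \<oplus>\<^bsub>A\<^esub> free_eval \<phi> g"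
proof -
  let ?S = "{w. f w \<noteq> \<zero>} \<union> {w. g w \<noteq> \<zero>}"
  have S: "finite ?S" "?S \<subseteq> lists X"
    using f g by (simp_all add: free_supp_finite free_supp_lists)
  have wp: "word_prod \<phi> w \<in> carrier A" if "w \<in> ?S" for w
    using that S(2) by (intro word_prod_closed[OF \<phi>]) blast
  have "free_eval \<phi> (f \<oplus>\<^bsub>free_algebra K X\<^esub> g) =
      (\<Oplus>\<^bsub>A\<^esub>w\<in>?S. (f \<oplus>\<^bsub>free_algebra K X\<^esub> g) w \<odot>\<^bsub>A\<^esub> word_prod \<phi> w)"
    by (rule free_eval_superset[OF \<phi> free_algebra_add_closed[OF f g] S(1) _ S(2)])
      (auto simp: free_algebra_add)
  also have "\<dots> = (\<Oplus>\<^bsub>A\<^esub>w\<in>?S. f w \<odot>\<^bsub>A\<^esub> word_prod \<phi> w \<oplus>\<^bsub>A\<^esub> g w \<odot>\<^bsub>A\<^esub> word_prod \<phi> w)"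
    by (rule finsum_cong') (use f g wp in \<open>auto simp: free_algebra_add smult_l_distr\<close>)
  also have "\<dots> = (\<Oplus>\<^bsub>A\<^esub>w\<in>?S. f w \<odot>\<^bsub>A\<^esub> word_prod \<phi> w) \<oplus>\<^bsub>A\<^esub> (\<Oplus>\<^bsub>A\<^esub>w\<in>?S. g w \<odot>\<^bsub>A\<^esub> word_prod \<phi> w)"
    by (rule finsum_addf) (use f g wp in auto)
  also have "\<dots> = free_eval \<phi> f \<oplus>\<^bsub>A\<^esub> free_eval \<phi> g"
    by (subst (1 2) free_eval_superset[OF \<phi> _ S(1) _ S(2)]) (use f g in auto)
  finally show ?thesis .
qed

lemma free_eval_smult:
  assumes \<phi>: "\<phi> \<in> X \<rightarrow> carrier A" and c: "c \<in> carrier K" and f: "f \<in> carrier (free_algebra K X)"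
  shows "free_eval \<phi> (c \<odot>\<^bsub>free_algebra K X\<^esub> f) = c \<odot>\<^bsub>A\<^esub> free_eval \<phi> f"
proof -
  interpret F: unital_algebra K "free_algebra K X" by (rule free_algebra_unital_algebra)
  show ?thesis using f
  proof (induction rule: free_algebra_induct)
    case zero
    have "free_eval \<phi> \<zero>\<^bsub>free_algebra K X\<^esub> = \<zero>\<^bsub>A\<^esub>" by (simp add: free_eval_def free_algebra_zero)
    with c show ?case by simp
  next
    case (monom d w)
    then have "c \<odot>\<^bsub>free_algebra K X\<^esub> free_monom K d w = free_monom K (c \<otimes> d) w"
      using c by (auto simp: free_algebra_smult free_monom_def)
    then show ?case
      using monom c word_prod_closed[OF \<phi>, of w] by (simp add: free_eval_monom[OF \<phi>] smult_assoc1)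
  qed (use c in \<open>simp_all add: F.smult_r_distr smult_r_distr free_eval_add[OF \<phi>] free_eval_closed[OF \<phi>]\<close>)
qed

text \<open>Both sides are additive in \<open>f\<close> and in \<open>g\<close>, which reduces the
  claim to monomials; there it says that the product over a concatenation splits and that scalars
  can be pulled out of a product.\<close>

lemma free_eval_mult:
  assumes \<phi>: "\<phi> \<in> X \<rightarrow> carrier A"
    and f: "f \<in> carrier (free_algebra K X)" and g: "g \<in> carrier (free_algebra K X)"
  shows "free_eval \<phi> (f \<otimes>\<^bsub>free_algebra K X\<^esub> g) = free_eval \<phi> f \<otimes>\<^bsub>A\<^esub> free_eval \<phi> g"
proof -
  interpret F: unital_algebra K "free_algebra K X" by (rule free_algebra_unital_algebra)
  have zero: "free_eval \<phi> \<zero>\<^bsub>free_algebra K X\<^esub> = \<zero>\<^bsub>A\<^esub>"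
    by (simp add: free_eval_def free_algebra_zero)
  note simps = zero free_eval_add[OF \<phi>] free_eval_closed[OF \<phi>] F.l_distr F.r_distr l_distr r_distr
    free_monom_closed
  show ?thesis using f
  proof (induction rule: free_algebra_induct)
    case (monom c u)
    show ?case using g
    proof (induction rule: free_algebra_induct)
      case (monom d v)
      note wp = word_prod_closed[OF \<phi> \<open>u \<in> lists X\<close>] word_prod_closed[OF \<phi> \<open>v \<in> lists X\<close>]
      have "(c \<odot>\<^bsub>A\<^esub> word_prod \<phi> u) \<otimes>\<^bsub>A\<^esub> (d \<odot>\<^bsub>A\<^esub> word_prod \<phi> v) =
          (c \<otimes> d) \<odot>\<^bsub>A\<^esub> (word_prod \<phi> u \<otimes>\<^bsub>A\<^esub> word_prod \<phi> v)"
        using monom \<open>c \<in> carrier K\<close> wp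
        by (simp add: smult_mult_left[of c] smult_mult_right[of d] smult_assoc1 R.m_comm[of c d])
      then show ?case
        using monom \<open>c \<in> carrier K\<close> \<open>u \<in> lists X\<close>
        by (simp add: free_monom_mult free_eval_monom[OF \<phi>] word_prod_append[OF \<phi>])
    qed (use monom in \<open>simp_all add: simps\<close>)
  qed (use g in \<open>simp_all add: simps\<close>)
qed

text \<open>This is the existence half of the universal property of the free algebra. Homomorphisms
  out of a free product arise by evaluating here and then passing to the quotient.\<close>

lemma free_eval_algebra_hom:
  assumes \<phi>: "\<phi> \<in> X \<rightarrow> carrier A"
  shows "free_eval \<phi> \<in> algebra_homs K (free_algebra K X) A"
proof (rule algebra_homsI)
  show "free_eval \<phi> \<one>\<^bsub>free_algebra K X\<^esub> = \<one>\<^bsub>A\<^esub>"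
    by (simp add: free_one_eq_monom free_eval_monom[OF \<phi>]) (simp add: word_prod_def)
qed (use \<phi> in \<open>simp_all add: free_eval_closed free_eval_add free_eval_mult free_eval_smult\<close>)

end

section \<open>Quotient algebras\<close>

lemma quot_algebra_carrier: "carrier (quot_algebra A I) = (\<lambda>x. I +>\<^bsub>A\<^esub> x) ` carrier A"
  by (auto simp: quot_algebra_def FactRing_def A_RCOSETS_def')

context unital_algebra
begin

text \<open>\<open>quot_algebra A I\<close> shares its ring operations with \<open>A Quot I\<close>
  but is a different record, so the ring laws are carried over field by field.\<close>

lemma quot_algebra_ring:
  assumes "ideal I A" shows "ring (quot_algebra A I)"
proof -
  interpret Q: ring "A Quot I" by (rule ideal.quotient_is_ring[OF assms])
  show ?thesis
  proof (rule ringI)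
    show "abelian_group (quot_algebra A I)"
    proof (rule abelian_groupI)
      fix X assume "X \<in> carrier (quot_algebra A I)"
      then show "\<exists>Y\<in>carrier (quot_algebra A I). Y \<oplus>\<^bsub>quot_algebra A I\<^esub> X = \<zero>\<^bsub>quot_algebra A I\<^esub>"
        by (intro bexI[of _ "\<ominus>\<^bsub>A Quot I\<^esub> X"]) (simp_all add: quot_algebra_def Q.l_neg)
    qed (simp_all add: quot_algebra_def Q.a_ac)
    show "Group.monoid (quot_algebra A I)"
      by (rule monoidI) (simp_all add: quot_algebra_def Q.m_assoc)
  qed (simp_all add: quot_algebra_def Q.l_distr Q.r_distr)
qed

text \<open>Scaling by \<open>c\<close> is multiplication by \<open>c \<odot> \<one>\<close>, so
  ring ideals are automatically stable under \<open>K\<close>; this is why \<open>Idl\<close>, which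
  knows only the ring structure, is adequate for quotients of algebras.\<close>

lemma ideal_smult_closed:
  assumes "ideal I A" "c \<in> carrier K" "x \<in> I"
  shows "c \<odot>\<^bsub>A\<^esub> x \<in> I"
proof -
  interpret ideal I A by fact
  show ?thesis using assms(2,3) by (metis Icarr I_l_closed one_closed smult_as_mult smult_closed)
qed

lemma
  assumes I: "ideal I A"
  shows quot_algebra_add: "\<lbrakk>x \<in> carrier A; y \<in> carrier A\<rbrakk> \<Longrightarrow>
      (I +>\<^bsub>A\<^esub> x) \<oplus>\<^bsub>quot_algebra A I\<^esub> (I +>\<^bsub>A\<^esub> y) = I +>\<^bsub>A\<^esub> (x \<oplus>\<^bsub>A\<^esub> y)"
    and quot_algebra_mult: "\<lbrakk>x \<in> carrier A; y \<in> carrier A\<rbrakk> \<Longrightarrow>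
      (I +>\<^bsub>A\<^esub> x) \<otimes>\<^bsub>quot_algebra A I\<^esub> (I +>\<^bsub>A\<^esub> y) = I +>\<^bsub>A\<^esub> (x \<otimes>\<^bsub>A\<^esub> y)"
    and quot_algebra_one: "\<one>\<^bsub>quot_algebra A I\<^esub> = I +>\<^bsub>A\<^esub> \<one>\<^bsub>A\<^esub>"
    and quot_algebra_smult: "\<lbrakk>c \<in> carrier K; x \<in> carrier A\<rbrakk> \<Longrightarrow>
      c \<odot>\<^bsub>quot_algebra A I\<^esub> (I +>\<^bsub>A\<^esub> x) = I +>\<^bsub>A\<^esub> (c \<odot>\<^bsub>A\<^esub> x)"
proof -
  interpret I: ideal I A by fact
  show "(I +>\<^bsub>A\<^esub> x) \<oplus>\<^bsub>quot_algebra A I\<^esub> (I +>\<^bsub>A\<^esub> y) = I +>\<^bsub>A\<^esub> (x \<oplus>\<^bsub>A\<^esub> y)"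
    "(I +>\<^bsub>A\<^esub> x) \<otimes>\<^bsub>quot_algebra A I\<^esub> (I +>\<^bsub>A\<^esub> y) = I +>\<^bsub>A\<^esub> (x \<otimes>\<^bsub>A\<^esub> y)"
    if "x \<in> carrier A" "y \<in> carrier A"
    using that by (simp_all add: quot_algebra_def FactRing_def I.rcoset_mult_add I.a_rcos_sum)
  show "\<one>\<^bsub>quot_algebra A I\<^esub> = I +>\<^bsub>A\<^esub> \<one>\<^bsub>A\<^esub>"
    by (simp add: quot_algebra_def FactRing_def)
  show "c \<odot>\<^bsub>quot_algebra A I\<^esub> (I +>\<^bsub>A\<^esub> x) = I +>\<^bsub>A\<^esub> (c \<odot>\<^bsub>A\<^esub> x)"
    if c: "c \<in> carrier K" and x: "x \<in> carrier A"
  proof -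
    \<comment> \<open>Scaling a coset is defined as a union over all its members \<open>y\<close>;
      stability of \<open>I\<close> under scalars makes every member contribute the same
      coset.\<close>
    have "I +>\<^bsub>A\<^esub> (c \<odot>\<^bsub>A\<^esub> y) = I +>\<^bsub>A\<^esub> (c \<odot>\<^bsub>A\<^esub> x)" if "y \<in> I +>\<^bsub>A\<^esub> x" for y
    proof -
      from that obtain i where i: "i \<in> I" "y = i \<oplus>\<^bsub>A\<^esub> x" by (auto simp: a_r_coset_def')
      then have "c \<odot>\<^bsub>A\<^esub> y = c \<odot>\<^bsub>A\<^esub> i \<oplus>\<^bsub>A\<^esub> c \<odot>\<^bsub>A\<^esub> x"
        using c x by (simp add: smult_r_distr I.Icarr)
      then have "c \<odot>\<^bsub>A\<^esub> y \<in> I +>\<^bsub>A\<^esub> (c \<odot>\<^bsub>A\<^esub> x)"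
        using ideal_smult_closed[OF I c i(1)] by (auto simp: a_r_coset_def')
      then show ?thesis
        using c x by (intro a_repr_independence[symmetric] I.a_subgroup) auto
    qed
    then have "(\<Union>y\<in>I +>\<^bsub>A\<^esub> x. I +>\<^bsub>A\<^esub> (c \<odot>\<^bsub>A\<^esub> y)) = (\<Union>y\<in>I +>\<^bsub>A\<^esub> x. I +>\<^bsub>A\<^esub> (c \<odot>\<^bsub>A\<^esub> x))"
      by (rule SUP_cong[OF refl])
    also have "\<dots> = I +>\<^bsub>A\<^esub> (c \<odot>\<^bsub>A\<^esub> x)"
      using I.a_rcos_self[OF x] by (intro UN_constant_eq) auto
    finally show ?thesis by (simp add: quot_algebra_def)
  qed
qed

lemma quot_algebra_unital_algebra:
  assumes I: "ideal I A"
  shows "unital_algebra K (quot_algebra A I)"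
proof -
  interpret Q: ring "quot_algebra A I" by (rule quot_algebra_ring[OF I])
  note simps = quot_algebra_add[OF I] quot_algebra_mult[OF I] quot_algebra_smult[OF I]
  have rep: "\<exists>x\<in>carrier A. X = I +>\<^bsub>A\<^esub> x" if "X \<in> carrier (quot_algebra A I)" for X
    using that by (auto simp: quot_algebra_carrier)
  have closed: "I +>\<^bsub>A\<^esub> x \<in> carrier (quot_algebra A I)" if "x \<in> carrier A" for x
    using that by (simp add: quot_algebra_carrier)
  have "Module.module K (quot_algebra A I)"
    by (rule moduleI[OF is_cring Q.is_abelian_group]; (drule rep)+; elim bexE)
      (simp_all add: closed simps smult_l_distr smult_r_distr smult_assoc1)
  moreover have "unital_algebra_axioms K (quot_algebra A I)"
    by (rule unital_algebra_axioms.intro; (drule rep)+; elim bexE)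
      (simp_all add: simps smult_mult_left smult_mult_right)
  ultimately show ?thesis
    by (intro unital_algebra.intro Q.ring_axioms)
qed

lemma quot_algebra_proj:
  assumes I: "ideal I A"
  shows "(+>\<^bsub>A\<^esub>) I \<in> algebra_homs K A (quot_algebra A I)"
  by (rule algebra_homsI)
    (use I in \<open>auto simp: quot_algebra_carrier quot_algebra_add quot_algebra_mult quot_algebra_one
      quot_algebra_smult\<close>)

lemma quot_algebra_proj_mem:
  assumes "ideal I A" "x \<in> I"
  shows "I +>\<^bsub>A\<^esub> x = \<zero>\<^bsub>quot_algebra A I\<^esub>"
proof -
  interpret I: ideal I A by fact
  show ?thesis using I.a_rcos_const[OF assms(2)] by (simp add: quot_algebra_def FactRing_def)
qed

text \<open>The kernel of \<open>h\<close> is an ideal containing \<open>S\<close>, hence contains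
  the least such ideal; \<open>h\<close> is therefore constant on cosets.\<close>

lemma quot_algebra_lift:
  assumes B: "unital_algebra K B" and h: "h \<in> algebra_homs K A B"
    and S: "S \<subseteq> carrier A" "\<And>s. s \<in> S \<Longrightarrow> h s = \<zero>\<^bsub>B\<^esub>"
  obtains h' where "h' \<in> algebra_homs K (quot_algebra A (Idl\<^bsub>A\<^esub> S)) B"
    "\<And>a. a \<in> carrier A \<Longrightarrow> h' ((Idl\<^bsub>A\<^esub> S) +>\<^bsub>A\<^esub> a) = h a"
proof -
  interpret B: unital_algebra K B by (rule B)
  have kernel: "ideal (a_kernel A B h) A"
    by (rule ring_hom_ring.kernel_is_ideal[OF algebra_homs_ring_hom_ring[OF h unital_algebra_axioms B]])
  define I where "I = Idl\<^bsub>A\<^esub> S"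
  have I: "ideal I A" unfolding I_def by (rule genideal_ideal[OF S(1)])
  interpret I: ideal I A by (rule I)
  have "I \<subseteq> a_kernel A B h"
    unfolding I_def by (rule genideal_minimal[OF kernel]) (use S in \<open>auto simp: a_kernel_def'\<close>)
  then have hI: "h i = \<zero>\<^bsub>B\<^esub>" if "i \<in> I" for i using that by (auto simp: a_kernel_def')
  \<comment> \<open>An arbitrary member serves as representative. In the coset of \<open>a\<close>
    it differs from \<open>a\<close> by an element of \<open>I\<close>, which \<open>h\<close>
    kills.\<close>
  define h' where "h' X = h (SOME x. x \<in> X)" for X
  have h': "h' (I +>\<^bsub>A\<^esub> a) = h a" if a: "a \<in> carrier A" for a
  proof -
    have "(SOME x. x \<in> I +>\<^bsub>A\<^esub> a) \<in> I +>\<^bsub>A\<^esub> a" by (rule someI) (rule I.a_rcos_self[OF a])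
    then obtain i where i: "i \<in> I" "(SOME x. x \<in> I +>\<^bsub>A\<^esub> a) = i \<oplus>\<^bsub>A\<^esub> a"
      by (auto simp: a_r_coset_def')
    then show ?thesis using a
      by (simp add: h'_def I.Icarr hI algebra_homs_add[OF h] algebra_homs_closed[OF h])
  qed
  have rep: "\<exists>x\<in>carrier A. X = I +>\<^bsub>A\<^esub> x" if "X \<in> carrier (quot_algebra A I)" for X
    using that by (auto simp: quot_algebra_carrier)
  have "h' \<in> algebra_homs K (quot_algebra A I) B"
    by (rule algebra_homsI; (drule rep)?; (drule rep)?; (elim bexE)?)
      (simp_all add: quot_algebra_add[OF I] quot_algebra_mult[OF I] quot_algebra_one[OF I]
        quot_algebra_smult[OF I] h'
        algebra_homs_closed[OF h] algebra_homs_mult[OF h] algebra_homs_add[OF h] algebra_homs_one[OF h]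
        algebra_homs_smult[OF h])
  then show thesis using that h' unfolding I_def by blast
qed

end

section \<open>Evaluation of polynomials\<close>

lemma UP_unital_algebra:
  assumes "cring K" shows "unital_algebra K (UP K)"
proof -
  interpret UP_cring K "UP K" by (rule UP_cring.intro[OF assms])
  have "unital_algebra_axioms K (UP K)"
  proof
    fix c p q assume c: "c \<in> carrier K" "p \<in> carrier (UP K)" "q \<in> carrier (UP K)"
    then show "(c \<odot>\<^bsub>UP K\<^esub> p) \<otimes>\<^bsub>UP K\<^esub> q = c \<odot>\<^bsub>UP K\<^esub> (p \<otimes>\<^bsub>UP K\<^esub> q)"
      by (rule UP_smult_assoc2)
    from c show "p \<otimes>\<^bsub>UP K\<^esub> (c \<odot>\<^bsub>UP K\<^esub> q) = c \<odot>\<^bsub>UP K\<^esub> (p \<otimes>\<^bsub>UP K\<^esub> q)"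
      using UP_smult_assoc2[of c q p] P.m_comm[of p q] P.m_comm[of p "c \<odot>\<^bsub>UP K\<^esub> q"] by simp
  qed
  then show ?thesis
    by (intro unital_algebra.intro module P.ring_axioms)
qed

text \<open>A polynomial is the sum of its monomials, and each monomial is a constant times a power
  of the indeterminate. Constants are written as multiples of \<open>\<one>\<close>, the form in
  which algebra homomorphisms can evaluate them.\<close>

lemma UP_induct [consumes 2, case_names const indet add mult]:
  assumes K: "cring K" and p: "p \<in> carrier (UP K)"
    and const: "\<And>c. c \<in> carrier K \<Longrightarrow> Q (c \<odot>\<^bsub>UP K\<^esub> \<one>\<^bsub>UP K\<^esub>)"
    and indet: "Q (monom (UP K) \<one>\<^bsub>K\<^esub> 1)"
    and add: "\<And>p q. \<lbrakk>p \<in> carrier (UP K); q \<in> carrier (UP K); Q p; Q q\<rbrakk> \<Longrightarrow> Q (p \<oplus>\<^bsub>UP K\<^esub> q)"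
    and mult: "\<And>p q. \<lbrakk>p \<in> carrier (UP K); q \<in> carrier (UP K); Q p; Q q\<rbrakk> \<Longrightarrow> Q (p \<otimes>\<^bsub>UP K\<^esub> q)"
  shows "Q p"
proof -
  interpret UP_cring K "UP K" by (rule UP_cring.intro[OF K])
  have const': "Q (monom (UP K) c 0)" if "c \<in> carrier K" for c
    using const[OF that] monom_mult_is_smult[OF that P.one_closed] that by simp
  have monom: "Q (monom (UP K) c n)" if c: "c \<in> carrier K" for c n
  proof (induction n)
    case 0
    show ?case by (rule const'[OF c])
  next
    case (Suc n)
    have "monom (UP K) c (Suc n) = monom (UP K) c n \<otimes>\<^bsub>UP K\<^esub> monom (UP K) \<one>\<^bsub>K\<^esub> 1"
      using monom_mult[OF c R.one_closed, of n 1] c by simp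
    with Suc indet c show ?case by (simp add: mult)
  qed
  \<comment> \<open>Membership in the carrier is proved along with \<open>Q\<close>, because the
    hypothesis \<open>add\<close> demands it of both summands.\<close>
  have "(\<Oplus>\<^bsub>UP K\<^esub>i\<in>{..n}. monom (UP K) (coeff (UP K) p i) i) \<in> carrier (UP K) \<and>
      Q (\<Oplus>\<^bsub>UP K\<^esub>i\<in>{..n}. monom (UP K) (coeff (UP K) p i) i)" for n
  proof (induction n)
    case 0
    show ?case using p monom[of "coeff (UP K) p 0" 0] by simp
  next
    case (Suc n)
    then show ?case using p by (simp add: P.finsum_Suc add monom Pi_def)
  qed
  from this[of "deg K p"] show ?thesis by (simp add: up_repr[OF p])
qed

text \<open>The double centralizer of \<open>q\<close> is a commutative subalgebra containing \<open>q\<close> and the scalars,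
  which makes the library's evaluation homomorphism into commutative rings applicable.\<close>

lemma (in unital_algebra) UP_lift:
  assumes q: "q \<in> carrier A"
  obtains e where "e \<in> algebra_homs K (UP K) A" "e (monom (UP K) \<one> 1) = q"
proof -
  define Z where "Z = {x \<in> carrier A. \<forall>y\<in>carrier A. y \<otimes>\<^bsub>A\<^esub> q = q \<otimes>\<^bsub>A\<^esub> y \<longrightarrow> x \<otimes>\<^bsub>A\<^esub> y = y \<otimes>\<^bsub>A\<^esub> x}"
  let ?Z = "A\<lparr>carrier := Z\<rparr>"
  define \<eta> where "\<eta> c = c \<odot>\<^bsub>A\<^esub> \<one>\<^bsub>A\<^esub>" for c
  have ZI: "x \<in> Z" if "x \<in> carrier A"
    "\<And>y. \<lbrakk>y \<in> carrier A; y \<otimes>\<^bsub>A\<^esub> q = q \<otimes>\<^bsub>A\<^esub> y\<rbrakk> \<Longrightarrow> x \<otimes>\<^bsub>A\<^esub> y = y \<otimes>\<^bsub>A\<^esub> x" for x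
    using that by (simp add: Z_def)
  have ZA: "x \<in> carrier A" if "x \<in> Z" for x using that by (simp add: Z_def)
  have Zcomm: "x \<otimes>\<^bsub>A\<^esub> y = y \<otimes>\<^bsub>A\<^esub> x"
    if "x \<in> Z" "y \<in> carrier A" "y \<otimes>\<^bsub>A\<^esub> q = q \<otimes>\<^bsub>A\<^esub> y" for x y
    using that by (simp add: Z_def)
  have "subring Z A"
  proof (rule subringI)
    fix x y assume x: "x \<in> Z" and y: "y \<in> Z"
    show "x \<otimes>\<^bsub>A\<^esub> y \<in> Z"
    proof (rule ZI)
      fix z assume z: "z \<in> carrier A" "z \<otimes>\<^bsub>A\<^esub> q = q \<otimes>\<^bsub>A\<^esub> z"
      have "(x \<otimes>\<^bsub>A\<^esub> y) \<otimes>\<^bsub>A\<^esub> z = x \<otimes>\<^bsub>A\<^esub> (z \<otimes>\<^bsub>A\<^esub> y)"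
        using ZA[OF x] ZA[OF y] z(1) by (simp add: m_assoc Zcomm[OF y z])
      also have "\<dots> = z \<otimes>\<^bsub>A\<^esub> (x \<otimes>\<^bsub>A\<^esub> y)"
        using ZA[OF x] ZA[OF y] z(1) by (simp add: m_assoc[symmetric] Zcomm[OF x z])
      finally show "(x \<otimes>\<^bsub>A\<^esub> y) \<otimes>\<^bsub>A\<^esub> z = z \<otimes>\<^bsub>A\<^esub> (x \<otimes>\<^bsub>A\<^esub> y)" .
    qed (use x y ZA in simp)
    show "x \<oplus>\<^bsub>A\<^esub> y \<in> Z"
      by (rule ZI) (use x y ZA in \<open>simp_all add: l_distr r_distr Zcomm\<close>)
  next
    fix x assume x: "x \<in> Z"
    show "\<ominus>\<^bsub>A\<^esub> x \<in> Z"
      by (rule ZI) (use x ZA in \<open>simp_all add: l_minus r_minus Zcomm\<close>)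
  next
    show "\<one>\<^bsub>A\<^esub> \<in> Z" by (rule ZI) simp_all
  qed (use ZA in blast)
  \<comment> \<open>\<open>q\<close> commutes with itself, so every \<open>y\<close> in
    \<open>Z\<close> commutes with \<open>q\<close>; hence \<open>y\<close> is among the elements
    with which \<open>x\<close> has to commute.\<close>
  moreover have "x \<otimes>\<^bsub>A\<^esub> y = y \<otimes>\<^bsub>A\<^esub> x" if "x \<in> Z" "y \<in> Z" for x y
    by (rule Zcomm[OF that(1) ZA[OF that(2)] Zcomm[OF that(2) q refl]])
  ultimately have "subcring Z A" by (rule subcringI)
  then have "cring ?Z" using subcring_iff[OF subcringE(1)] by blast
  have \<eta>Z: "\<eta> c \<in> Z" if "c \<in> carrier K" for c
    by (rule ZI) (use that in \<open>simp_all add: \<eta>_def smult_mult_left smult_mult_right\<close>)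
  have "\<eta> \<in> ring_hom K ?Z"
    by (rule ring_hom_memI)
      (simp_all add: \<eta>Z, simp_all add: \<eta>_def smult_l_distr smult_mult_left smult_assoc1)
  then interpret e: UP_pre_univ_prop K ?Z \<eta> "UP K"
    by (intro UP_pre_univ_propI is_cring \<open>cring ?Z\<close>)
  have qZ: "q \<in> carrier ?Z" using q by (simp add: ZI)
  define e where "e = eval K ?Z \<eta> q"
  have e: "e \<in> ring_hom (UP K) ?Z" unfolding e_def by (rule e.eval_ring_hom[OF qZ])
  have eZ: "e p \<in> Z" if "p \<in> carrier (UP K)" for p using ring_hom_closed[OF e that] by simp
  have "e \<in> algebra_homs K (UP K) A"
  proof (rule algebra_homsI)
    fix c p assume c: "c \<in> carrier K" and p: "p \<in> carrier (UP K)"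
    have "e (c \<odot>\<^bsub>UP K\<^esub> p) = e (monom (UP K) c 0) \<otimes>\<^bsub>A\<^esub> e p"
      using ring_hom_mult[OF e e.monom_closed[OF c] p, of 0] e.monom_mult_is_smult[OF c p] by simp
    also have "e (monom (UP K) c 0) = c \<odot>\<^bsub>A\<^esub> \<one>\<^bsub>A\<^esub>"
      using e.eval_const[OF qZ c] by (simp add: e_def \<eta>_def)
    finally show "e (c \<odot>\<^bsub>UP K\<^esub> p) = c \<odot>\<^bsub>A\<^esub> e p"
      using smult_as_mult[OF c ZA[OF eZ[OF p]]] by simp
  qed (use ring_hom_mult[OF e] ring_hom_add[OF e] ring_hom_one[OF e] eZ ZA in simp_all)
  moreover have "e (monom (UP K) \<one> 1) = q"
    unfolding e_def by (rule e.eval_monom1[OF qZ])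
  ultimately show thesis by (rule that)
qed

section \<open>Free products\<close>

lemma hom_relations_closed:
  assumes A: "unital_algebra K A" and F: "unital_algebra K F" and j: "j \<in> carrier A \<rightarrow> carrier F"
  shows "hom_relations K A F j \<subseteq> carrier F"
proof -
  interpret A: unital_algebra K A by (rule A)
  interpret F: unital_algebra K F by (rule F)
  have [simp]: "j a \<in> carrier F" if "a \<in> carrier A" for a using j that by blast
  show ?thesis by (auto simp: hom_relations_def)
qed

text \<open>Every relation measures a failure of \<open>j\<close> to be an algebra homomorphism, and
  \<open>h\<close> turns it into the corresponding failure of \<open>f\<close>, which is
  zero.\<close>

lemma algebra_homs_hom_relations:
  assumes A: "unital_algebra K A" and F: "unital_algebra K F" and E: "unital_algebra K E"
    and j: "j \<in> carrier A \<rightarrow> carrier F"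
    and h: "h \<in> algebra_homs K F E" and f: "f \<in> algebra_homs K A E"
    and hj: "\<And>a. a \<in> carrier A \<Longrightarrow> h (j a) = f a"
    and s: "s \<in> hom_relations K A F j"
  shows "h s = \<zero>\<^bsub>E\<^esub>"
proof -
  interpret A: unital_algebra K A by (rule A)
  interpret F: unital_algebra K F by (rule F)
  interpret E: unital_algebra K E by (rule E)
  have jF: "j a \<in> carrier F" if "a \<in> carrier A" for a using j that by blast
  have fE: "f a \<in> carrier E" if "a \<in> carrier A" for a by (rule algebra_homs_closed[OF f that])
  note minus = algebra_homs_minus[OF h F E]
  from s consider
      (add) a b where "a \<in> carrier A" "b \<in> carrier A" "s = j (a \<oplus>\<^bsub>A\<^esub> b) \<ominus>\<^bsub>F\<^esub> (j a \<oplus>\<^bsub>F\<^esub> j b)"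
    | (smult) c a where "c \<in> carrier K" "a \<in> carrier A" "s = j (c \<odot>\<^bsub>A\<^esub> a) \<ominus>\<^bsub>F\<^esub> (c \<odot>\<^bsub>F\<^esub> j a)"
    | (mult) a b where "a \<in> carrier A" "b \<in> carrier A" "s = j (a \<otimes>\<^bsub>A\<^esub> b) \<ominus>\<^bsub>F\<^esub> (j a \<otimes>\<^bsub>F\<^esub> j b)"
    | (one) "s = j \<one>\<^bsub>A\<^esub> \<ominus>\<^bsub>F\<^esub> \<one>\<^bsub>F\<^esub>"
    by (auto simp: hom_relations_def)
  then show ?thesis
  proof cases
    case add
    then show ?thesis
      by (simp add: minus jF hj fE algebra_homs_add[OF h] algebra_homs_add[OF f] E.r_right_minus_eq)
  next
    case smult
    then show ?thesis
      by (simp add: minus jF hj fE algebra_homs_smult[OF h] algebra_homs_smult[OF f] E.r_right_minus_eq)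
  next
    case mult
    then show ?thesis
      by (simp add: minus jF hj fE algebra_homs_mult[OF h] algebra_homs_mult[OF f] E.r_right_minus_eq)
  next
    case one
    then show ?thesis
      by (simp add: minus jF hj fE algebra_homs_one[OF h] algebra_homs_one[OF f] E.r_right_minus_eq)
  qed
qed

text \<open>Killing the relations forces the homomorphism laws. The ideal is only asked to contain
  them, so that a single ideal can serve both factors of a free product.\<close>

lemma quot_hom_relations_hom:
  assumes A: "unital_algebra K A" and F: "unital_algebra K F" and I: "ideal I F"
    and j: "j \<in> carrier A \<rightarrow> carrier F" and sub: "hom_relations K A F j \<subseteq> I"
  shows "(\<lambda>a. I +>\<^bsub>F\<^esub> j a) \<in> algebra_homs K A (quot_algebra F I)"
proof -
  interpret A: unital_algebra K A by (rule A)
  interpret F: unital_algebra K F by (rule F)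
  have jF: "j a \<in> carrier F" if "a \<in> carrier A" for a using j that by blast
  have eq: "I +>\<^bsub>F\<^esub> x = I +>\<^bsub>F\<^esub> y"
    if "x \<ominus>\<^bsub>F\<^esub> y \<in> hom_relations K A F j" "x \<in> carrier F" "y \<in> carrier F" for x y
    using F.quotient_eq_iff_same_a_r_cos[OF I that(2,3)] that(1) sub by blast
  note simps = F.quot_algebra_add[OF I] F.quot_algebra_mult[OF I] F.quot_algebra_one[OF I]
    F.quot_algebra_smult[OF I]
  show ?thesis
  proof (rule algebra_homsI)
    fix a assume a: "a \<in> carrier A"
    then show "I +>\<^bsub>F\<^esub> j a \<in> carrier (quot_algebra F I)" by (simp add: quot_algebra_carrier jF)
    fix b assume b: "b \<in> carrier A"
    have "j (a \<otimes>\<^bsub>A\<^esub> b) \<ominus>\<^bsub>F\<^esub> (j a \<otimes>\<^bsub>F\<^esub> j b) \<in> hom_relations K A F j"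
      unfolding hom_relations_def using a b by blast
    from eq[OF this] a b
    show "I +>\<^bsub>F\<^esub> j (a \<otimes>\<^bsub>A\<^esub> b) = (I +>\<^bsub>F\<^esub> j a) \<otimes>\<^bsub>quot_algebra F I\<^esub> (I +>\<^bsub>F\<^esub> j b)"
      by (simp add: simps jF)
    have "j (a \<oplus>\<^bsub>A\<^esub> b) \<ominus>\<^bsub>F\<^esub> (j a \<oplus>\<^bsub>F\<^esub> j b) \<in> hom_relations K A F j"
      unfolding hom_relations_def using a b by blast
    from eq[OF this] a b
    show "I +>\<^bsub>F\<^esub> j (a \<oplus>\<^bsub>A\<^esub> b) = (I +>\<^bsub>F\<^esub> j a) \<oplus>\<^bsub>quot_algebra F I\<^esub> (I +>\<^bsub>F\<^esub> j b)"
      by (simp add: simps jF)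
  next
    have "j \<one>\<^bsub>A\<^esub> \<ominus>\<^bsub>F\<^esub> \<one>\<^bsub>F\<^esub> \<in> hom_relations K A F j"
      unfolding hom_relations_def by blast
    from eq[OF this] show "I +>\<^bsub>F\<^esub> j \<one>\<^bsub>A\<^esub> = \<one>\<^bsub>quot_algebra F I\<^esub>"
      by (simp add: simps jF)
  next
    fix c a assume c: "c \<in> carrier K" and a: "a \<in> carrier A"
    have "j (c \<odot>\<^bsub>A\<^esub> a) \<ominus>\<^bsub>F\<^esub> (c \<odot>\<^bsub>F\<^esub> j a) \<in> hom_relations K A F j"
      unfolding hom_relations_def using a c by blast
    from eq[OF this] a c
    show "I +>\<^bsub>F\<^esub> j (c \<odot>\<^bsub>A\<^esub> a) = c \<odot>\<^bsub>quot_algebra F I\<^esub> (I +>\<^bsub>F\<^esub> j a)"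
      by (simp add: simps jF)
  qed
qed

section \<open>Universal property and generators of the coproduct of two algebras\<close>

locale two_algebras = A: unital_algebra K A + B: unital_algebra K B for K (structure) and A and B
begin

abbreviation "F \<equiv> free_algebra K (Sum_Type.Plus (carrier A) (carrier B))"
abbreviation "I \<equiv> free_product_ideal K A B"

lemma F_unital_algebra: "unital_algebra K F"
  by (rule A.free_algebra_unital_algebra)

sublocale F: unital_algebra K F by (rule F_unital_algebra)

lemma gen_closed:
  "(\<lambda>a. free_gen K (Inl a)) \<in> carrier A \<rightarrow> carrier F"
  "(\<lambda>b. free_gen K (Inr b)) \<in> carrier B \<rightarrow> carrier F"
  by (auto simp: free_gen_eq_monom intro!: A.free_monom_closed)

lemma relations_closed:
  "hom_relations K A F (\<lambda>a. free_gen K (Inl a)) \<union> hom_relations K B F (\<lambda>b. free_gen K (Inr b)) \<subseteq> carrier F"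
  using hom_relations_closed[OF A.unital_algebra_axioms F_unital_algebra gen_closed(1)]
    hom_relations_closed[OF B.unital_algebra_axioms F_unital_algebra gen_closed(2)] by blast

lemma I_ideal: "ideal I F"
  unfolding free_product_ideal_def Let_def by (rule F.genideal_ideal[OF relations_closed])

lemma relations_in_I:
  "hom_relations K A F (\<lambda>a. free_gen K (Inl a)) \<subseteq> I"
  "hom_relations K B F (\<lambda>b. free_gen K (Inr b)) \<subseteq> I"
  using F.genideal_self[OF relations_closed] unfolding free_product_ideal_def Let_def by blast+

lemma free_product_unital_algebra: "unital_algebra K (free_product K A B)"
  unfolding free_product_def by (rule F.quot_algebra_unital_algebra[OF I_ideal])

lemma free_product_inl_hom: "free_product_inl K A B \<in> algebra_homs K A (free_product K A B)"
  using quot_hom_relations_hom[OF A.unital_algebra_axioms F_unital_algebra I_ideal gen_closed(1)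
    relations_in_I(1)]
  by (simp add: free_product_def free_product_inl_def[abs_def])

lemma free_product_inr_hom: "free_product_inr K A B \<in> algebra_homs K B (free_product K A B)"
  using quot_hom_relations_hom[OF B.unital_algebra_axioms F_unital_algebra I_ideal gen_closed(2)
    relations_in_I(2)]
  by (simp add: free_product_def free_product_inr_def[abs_def])

text \<open>This is the universal property of the coproduct without its uniqueness part. Evaluating
  the letters by \<open>f\<close> on the left and by \<open>g\<close> on the right kills both
  families of relations, because \<open>f\<close> and \<open>g\<close> are homomorphisms.\<close>

lemma free_product_lift:
  assumes E: "unital_algebra K E" and f: "f \<in> algebra_homs K A E" and g: "g \<in> algebra_homs K B E"
  obtains h where "h \<in> algebra_homs K (free_product K A B) E"
    "\<And>a. a \<in> carrier A \<Longrightarrow> h (free_product_inl K A B a) = f a"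
    "\<And>b. b \<in> carrier B \<Longrightarrow> h (free_product_inr K A B b) = g b"
proof -
  interpret E: unital_algebra K E by (rule E)
  have \<phi>: "case_sum f g \<in> Sum_Type.Plus (carrier A) (carrier B) \<rightarrow> carrier E"
    using algebra_homs_closed[OF f] algebra_homs_closed[OF g] by auto
  let ?e = "E.free_eval (case_sum f g)"
  have e: "?e \<in> algebra_homs K F E" by (rule E.free_eval_algebra_hom[OF \<phi>])
  have l: "?e (free_gen K (Inl a)) = f a" if "a \<in> carrier A" for a
    using E.free_eval_gen[OF \<phi> InlI[OF that]] by simp
  have r: "?e (free_gen K (Inr b)) = g b" if "b \<in> carrier B" for b
    using E.free_eval_gen[OF \<phi> InrI[OF that]] by simp
  have "?e s = \<zero>\<^bsub>E\<^esub>" if "s \<in> hom_relations K A F (\<lambda>a. free_gen K (Inl a))" for s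
    using algebra_homs_hom_relations[OF A.unital_algebra_axioms F_unital_algebra E gen_closed(1) e f _ that]
    by (simp add: l)
  moreover have "?e s = \<zero>\<^bsub>E\<^esub>" if "s \<in> hom_relations K B F (\<lambda>b. free_gen K (Inr b))" for s
    using algebra_homs_hom_relations[OF B.unital_algebra_axioms F_unital_algebra E gen_closed(2) e g _ that]
    by (simp add: r)
  ultimately have rel: "?e s = \<zero>\<^bsub>E\<^esub>"
    if "s \<in> hom_relations K A F (\<lambda>a. free_gen K (Inl a)) \<union>
      hom_relations K B F (\<lambda>b. free_gen K (Inr b))" for s
    using that by blast
  from F.quot_algebra_lift[OF E e relations_closed rel]
  obtain h where h: "h \<in> algebra_homs K (free_product K A B) E"
    "\<And>x. x \<in> carrier F \<Longrightarrow> h (I +>\<^bsub>F\<^esub> x) = ?e x"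
    unfolding free_product_def free_product_ideal_def Let_def by blast
  show thesis
  proof (rule that[OF h(1)])
    fix a assume "a \<in> carrier A"
    then show "h (free_product_inl K A B a) = f a"
      using gen_closed(1) by (simp add: free_product_inl_def h(2) l Pi_iff)
  next
    fix b assume "b \<in> carrier B"
    then show "h (free_product_inr K A B b) = g b"
      using gen_closed(2) by (simp add: free_product_inr_def h(2) r Pi_iff)
  qed
qed

text \<open>The images of the two factors generate the coproduct already as a ring: a word is a
  product of its letters, and the scalars come from \<open>A\<close>.\<close>

lemma free_product_induct [consumes 1, case_names inl inr add mult]:
  assumes x: "x \<in> carrier (free_product K A B)"
    and inl: "\<And>a. a \<in> carrier A \<Longrightarrow> Q (free_product_inl K A B a)"
    and inr: "\<And>b. b \<in> carrier B \<Longrightarrow> Q (free_product_inr K A B b)"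
    and add: "\<And>x y. \<lbrakk>x \<in> carrier (free_product K A B); y \<in> carrier (free_product K A B); Q x; Q y\<rbrakk> \<Longrightarrow>
      Q (x \<oplus>\<^bsub>free_product K A B\<^esub> y)"
    and mult: "\<And>x y. \<lbrakk>x \<in> carrier (free_product K A B); y \<in> carrier (free_product K A B); Q x; Q y\<rbrakk> \<Longrightarrow>
      Q (x \<otimes>\<^bsub>free_product K A B\<^esub> y)"
  shows "Q x"
proof -
  interpret FP: unital_algebra K "free_product K A B" by (rule free_product_unital_algebra)
  define \<pi> where "\<pi> f = I +>\<^bsub>F\<^esub> f" for f
  have \<pi>: "\<pi> \<in> algebra_homs K F (free_product K A B)"
    using F.quot_algebra_proj[OF I_ideal] by (simp add: \<pi>_def[abs_def] free_product_def)
  note inl_hom = free_product_inl_hom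
  have const: "Q (c \<odot>\<^bsub>free_product K A B\<^esub> \<one>\<^bsub>free_product K A B\<^esub>)" if "c \<in> carrier K" for c
    using inl[of "c \<odot>\<^bsub>A\<^esub> \<one>\<^bsub>A\<^esub>"] that
    by (simp add: algebra_homs_smult[OF inl_hom] algebra_homs_one[OF inl_hom])
  have monom: "Q (\<pi> (free_monom K c w))"
    if c: "c \<in> carrier K" and w: "w \<in> lists (Sum_Type.Plus (carrier A) (carrier B))" for c w
    using w
  proof (induction w)
    case Nil
    have "free_monom K c [] = c \<odot>\<^bsub>F\<^esub> \<one>\<^bsub>F\<^esub>"
      using c by (auto simp: free_algebra_smult free_one_eq_monom free_monom_def)
    then show ?case
      using const[OF c] c by (simp add: algebra_homs_smult[OF \<pi>] algebra_homs_one[OF \<pi>])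
  next
    case (Cons z w)
    \<comment> \<open>The scalar stays with the tail while letters are split off, so it is met only
      at the empty word, where it is a multiple of one.\<close>
    have "free_monom K c (z # w) = free_gen K z \<otimes>\<^bsub>F\<^esub> free_monom K c w"
      using A.free_monom_mult[OF A.R.one_closed c, where u = "[z]" and v = w] c by (simp add: free_gen_eq_monom)
    moreover have "Q (\<pi> (free_gen K z))"
      using Cons.hyps(1)
    proof (elim PlusE)
      fix a assume "a \<in> carrier A" "z = Inl a"
      then show ?thesis using inl by (simp add: \<pi>_def free_product_inl_def)
    next
      fix b assume "b \<in> carrier B" "z = Inr b"
      then show ?thesis using inr by (simp add: \<pi>_def free_product_inr_def)
    qed
    moreover have "free_gen K z \<in> carrier F" "free_monom K c w \<in> carrier F"
      using Cons.hyps c by (simp_all add: free_gen_eq_monom A.free_monom_closed)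
    ultimately show ?case
      using Cons.IH by (simp add: algebra_homs_mult[OF \<pi>] algebra_homs_closed[OF \<pi>] mult)
  qed
  have "Q (\<pi> f)" if "f \<in> carrier F" for f
    using that
  proof (induction rule: A.free_algebra_induct)
    case zero
    \<comment> \<open>Zero is reached as the image of the zero of \<open>A\<close>.\<close>
    have "\<pi> \<zero>\<^bsub>F\<^esub> = free_product_inl K A B \<zero>\<^bsub>A\<^esub>"
      by (simp add: algebra_homs_zero[OF \<pi> F_unital_algebra free_product_unital_algebra]
        algebra_homs_zero[OF inl_hom A.unital_algebra_axioms free_product_unital_algebra])
    then show ?case by (simp add: inl)
  next
    case (add f g)
    then show ?case
      by (simp add: algebra_homs_add[OF \<pi>] algebra_homs_closed[OF \<pi>] assms(4))
  qed (rule monom)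
  moreover obtain f where "f \<in> carrier F" "x = \<pi> f"
    using x by (auto simp: free_product_def quot_algebra_carrier \<pi>_def)
  ultimately show ?thesis by simp
qed

end

section \<open>The ring of Rota-Baxter operators\<close>

text \<open>The generators of \<open>URB_ideal\<close>, abstracted from the ambient algebra: the
  same expression is needed in \<open>free_RB\<close>, in its quotient and in the endomorphism
  algebra of a module, and homomorphisms carry one into the other.\<close>

definition URB_relator ::
  "('k, 'f, 's) module_scheme \<Rightarrow> ('r \<Rightarrow> 'f) \<Rightarrow> 'f \<Rightarrow> ('r \<Rightarrow> 'r) \<Rightarrow> 'k \<Rightarrow> 'r \<Rightarrow> 'f" where
  "URB_relator F i q P lam r =
     (q \<otimes>\<^bsub>F\<^esub> i r \<otimes>\<^bsub>F\<^esub> q) \<ominus>\<^bsub>F\<^esub> (i (P r) \<otimes>\<^bsub>F\<^esub> q) \<oplus>\<^bsub>F\<^esub> (q \<otimes>\<^bsub>F\<^esub> i (P r)) \<oplus>\<^bsub>F\<^esub> (lam \<odot>\<^bsub>F\<^esub> (q \<otimes>\<^bsub>F\<^esub> i r))"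

lemma (in ring) minus_add_eq_zero_iff:
  assumes "a \<in> carrier R" "b \<in> carrier R" "c \<in> carrier R" "d \<in> carrier R"
  shows "a \<ominus> b \<oplus> c \<oplus> d = \<zero> \<longleftrightarrow> b = a \<oplus> c \<oplus> d"
proof -
  have "a \<ominus> b \<oplus> c \<oplus> d = (a \<oplus> c \<oplus> d) \<ominus> b"
    using assms by (simp add: a_minus_def a_ac)
  also have "\<dots> = \<zero> \<longleftrightarrow> a \<oplus> c \<oplus> d = b"
    using assms by (simp add: r_right_minus_eq)
  finally show ?thesis by auto
qed

text \<open>Isolating the only negative term gives the form of the relation that, in an algebra of
  endomorphisms, is the Rota-Baxter identity of the operator \<open>q\<close>.\<close>

lemma (in unital_algebra) URB_relator_eq_zero_iff:
  assumes "q \<in> carrier A" "i r \<in> carrier A" "i (P r) \<in> carrier A" "lam \<in> carrier K"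
  shows "URB_relator A i q P lam r = \<zero>\<^bsub>A\<^esub> \<longleftrightarrow>
    i (P r) \<otimes>\<^bsub>A\<^esub> q = (q \<otimes>\<^bsub>A\<^esub> i r \<otimes>\<^bsub>A\<^esub> q) \<oplus>\<^bsub>A\<^esub> (q \<otimes>\<^bsub>A\<^esub> i (P r)) \<oplus>\<^bsub>A\<^esub> (lam \<odot>\<^bsub>A\<^esub> (q \<otimes>\<^bsub>A\<^esub> i r))"
  unfolding URB_relator_def using assms by (intro minus_add_eq_zero_iff) simp_all

lemma algebra_homs_URB_relator:
  assumes h: "h \<in> algebra_homs K A B" and A: "unital_algebra K A" and B: "unital_algebra K B"
    and "q \<in> carrier A" "i r \<in> carrier A" "i (P r) \<in> carrier A" "lam \<in> carrier K"
  shows "h (URB_relator A i q P lam r) = URB_relator B (\<lambda>r. h (i r)) (h q) P lam r"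
proof -
  interpret A: unital_algebra K A by (rule A)
  show ?thesis
    using assms(4-) by (simp add: URB_relator_def algebra_homs_minus[OF h A B] algebra_homs_add[OF h]
      algebra_homs_mult[OF h] algebra_homs_smult[OF h])
qed

section \<open>Generators, relations and universal property of the operator ring\<close>

context rota_baxter_algebra
begin

interpretation FP: two_algebras K R "UP K"
  by (intro two_algebras.intro unital_algebra_axioms UP_unital_algebra is_cring)

lemma free_RB_unital_algebra: "unital_algebra K (free_RB K R)"
  unfolding free_RB_def by (rule FP.free_product_unital_algebra)

lemma free_RB_of_hom: "free_RB_of K R \<in> algebra_homs K R (free_RB K R)"
  using FP.free_product_inl_hom by (simp add: free_RB_def free_RB_of_def[abs_def])

lemma indet_closed: "monom (UP K) \<one> 1 \<in> carrier (UP K)"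
proof -
  interpret UP_cring K "UP K" by (rule UP_cring.intro[OF is_cring])
  show ?thesis by simp
qed

lemma free_RB_Q_closed: "free_RB_Q K R \<in> carrier (free_RB K R)"
  using algebra_homs_closed[OF FP.free_product_inr_hom indet_closed]
  by (simp add: free_RB_Q_def free_RB_def)

text \<open>A homomorphism from \<open>UP K\<close> to any algebra is obtained by choosing the value
  of the indeterminate, so on the second factor of the coproduct the single element \<open>q\<close>
  is enough data.\<close>

lemma free_RB_lift:
  assumes E: "unital_algebra K E" and j: "j \<in> algebra_homs K R E" and q: "q \<in> carrier E"
  obtains h where "h \<in> algebra_homs K (free_RB K R) E"
    "\<And>r. r \<in> carrier R \<Longrightarrow> h (free_RB_of K R r) = j r" "h (free_RB_Q K R) = q"
proof -
  obtain e where e: "e \<in> algebra_homs K (UP K) E" "e (monom (UP K) \<one> 1) = q"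
    by (rule unital_algebra.UP_lift[OF E q])
  obtain h where h: "h \<in> algebra_homs K (free_product K R (UP K)) E"
    "\<And>r. r \<in> carrier R \<Longrightarrow> h (free_product_inl K R (UP K) r) = j r"
    "\<And>p. p \<in> carrier (UP K) \<Longrightarrow> h (free_product_inr K R (UP K) p) = e p"
    using FP.free_product_lift[OF E j e(1)] by blast
  show thesis
    by (rule that[of h])
      (use h e(2) indet_closed in \<open>simp_all add: free_RB_def free_RB_of_def free_RB_Q_def\<close>)
qed

lemma free_RB_induct [consumes 1, case_names of_elem Q add mult]:
  assumes x: "x \<in> carrier (free_RB K R)"
    and of_elem: "\<And>r. r \<in> carrier R \<Longrightarrow> Q (free_RB_of K R r)"
    and Q: "Q (free_RB_Q K R)"
    and add: "\<And>x y. \<lbrakk>x \<in> carrier (free_RB K R); y \<in> carrier (free_RB K R); Q x; Q y\<rbrakk> \<Longrightarrow>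
      Q (x \<oplus>\<^bsub>free_RB K R\<^esub> y)"
    and mult: "\<And>x y. \<lbrakk>x \<in> carrier (free_RB K R); y \<in> carrier (free_RB K R); Q x; Q y\<rbrakk> \<Longrightarrow>
      Q (x \<otimes>\<^bsub>free_RB K R\<^esub> y)"
  shows "Q x"
proof -
  note inl = FP.free_product_inl_hom and inr = FP.free_product_inr_hom
  have "Q (free_product_inr K R (UP K) p)" if "p \<in> carrier (UP K)" for p
    using is_cring that
  proof (induction rule: UP_induct)
    case (const c)
    interpret U: unital_algebra K "UP K" by (rule UP_unital_algebra[OF is_cring])
    \<comment> \<open>The scalars of the two factors are identified in the coproduct, so a constant
      polynomial is covered by the case of elements of \<open>R\<close>.\<close>
    have "free_product_inr K R (UP K) (c \<odot>\<^bsub>UP K\<^esub> \<one>\<^bsub>UP K\<^esub>) = free_product_inl K R (UP K) (c \<odot>\<^bsub>R\<^esub> \<one>\<^bsub>R\<^esub>)"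
      using const by (simp add: algebra_homs_smult[OF inl] algebra_homs_smult[OF inr]
        algebra_homs_one[OF inl] algebra_homs_one[OF inr])
    then show ?case using of_elem[of "c \<odot>\<^bsub>R\<^esub> \<one>\<^bsub>R\<^esub>"] const by (simp add: free_RB_of_def)
  next
    case indet
    show ?case using Q by (simp add: free_RB_Q_def)
  next
    case (add p q)
    then show ?case
      using assms(4) algebra_homs_closed[OF inr] by (simp add: algebra_homs_add[OF inr] free_RB_def)
  next
    case (mult p q)
    then show ?case
      using assms(5) algebra_homs_closed[OF inr] by (simp add: algebra_homs_mult[OF inr] free_RB_def)
  qed
  with x show ?thesis
    unfolding free_RB_def
    by (induction rule: FP.free_product_induct)
      (use of_elem add mult in \<open>simp_all add: free_RB_of_def free_RB_def\<close>)
qed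

lemma URB_ideal_eq:
  "URB_ideal K R P lam =
    Idl\<^bsub>free_RB K R\<^esub> (URB_relator (free_RB K R) (free_RB_of K R) (free_RB_Q K R) P lam ` carrier R)"
  unfolding URB_ideal_def Let_def URB_relator_def image_def by (rule arg_cong2[where f = genideal]) auto

lemma URB_relators_closed:
  "URB_relator (free_RB K R) (free_RB_of K R) (free_RB_Q K R) P lam ` carrier R \<subseteq> carrier (free_RB K R)"
proof -
  interpret F: unital_algebra K "free_RB K R" by (rule free_RB_unital_algebra)
  show ?thesis
    using algebra_homs_closed[OF free_RB_of_hom] free_RB_Q_closed weight P_closed
    by (auto simp: URB_relator_def)
qed

lemma URB_ideal: "ideal (URB_ideal K R P lam) (free_RB K R)"
proof -
  interpret F: unital_algebra K "free_RB K R" by (rule free_RB_unital_algebra)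
  show ?thesis unfolding URB_ideal_eq by (rule F.genideal_ideal[OF URB_relators_closed])
qed

lemma URB_unital_algebra: "unital_algebra K (URB K R P lam)"
  unfolding URB_def
  by (rule unital_algebra.quot_algebra_unital_algebra[OF free_RB_unital_algebra URB_ideal])

lemma URB_proj: "(+>\<^bsub>free_RB K R\<^esub>) (URB_ideal K R P lam) \<in> algebra_homs K (free_RB K R) (URB K R P lam)"
  unfolding URB_def
  by (rule unital_algebra.quot_algebra_proj[OF free_RB_unital_algebra URB_ideal])

lemma URB_of_hom: "URB_of K R P lam \<in> algebra_homs K R (URB K R P lam)"
  using algebra_homs_comp[OF free_RB_of_hom URB_proj] by (simp add: URB_of_def[abs_def] comp_def)

lemma URB_Q_closed: "URB_Q K R P lam \<in> carrier (URB K R P lam)"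
  unfolding URB_Q_def by (rule algebra_homs_closed[OF URB_proj free_RB_Q_closed])

lemma URB_relation:
  assumes r: "r \<in> carrier R"
  shows "URB_relator (URB K R P lam) (URB_of K R P lam) (URB_Q K R P lam) P lam r = \<zero>\<^bsub>URB K R P lam\<^esub>"
proof -
  interpret F: unital_algebra K "free_RB K R" by (rule free_RB_unital_algebra)
  let ?s = "URB_relator (free_RB K R) (free_RB_of K R) (free_RB_Q K R) P lam r"
  have "?s \<in> URB_ideal K R P lam"
    unfolding URB_ideal_eq using F.genideal_self[OF URB_relators_closed] r by blast
  then have "URB_ideal K R P lam +>\<^bsub>free_RB K R\<^esub> ?s = \<zero>\<^bsub>URB K R P lam\<^esub>"
    unfolding URB_def by (rule F.quot_algebra_proj_mem[OF URB_ideal])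
  moreover have "URB_ideal K R P lam +>\<^bsub>free_RB K R\<^esub> ?s =
      URB_relator (URB K R P lam) (URB_of K R P lam) (URB_Q K R P lam) P lam r"
    using algebra_homs_URB_relator[OF URB_proj free_RB_unital_algebra URB_unital_algebra
      free_RB_Q_closed _ _ weight, where i = "free_RB_of K R" and r = r]
      algebra_homs_closed[OF free_RB_of_hom] r P_closed
    by (simp add: URB_of_def[abs_def] URB_Q_def)
  ultimately show ?thesis by simp
qed

text \<open>The lift to \<open>free_RB\<close> maps the relator of \<open>r\<close> to the same
  expression in \<open>j\<close> and \<open>q\<close>, which vanishes by \<open>rel\<close>, so it
  factors through the quotient. Modules over \<open>URB\<close> are produced from this.\<close>

lemma URB_lift:
  assumes E: "unital_algebra K E" and j: "j \<in> algebra_homs K R E" and q: "q \<in> carrier E"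
    and rel: "\<And>r. r \<in> carrier R \<Longrightarrow> URB_relator E j q P lam r = \<zero>\<^bsub>E\<^esub>"
  obtains h where "h \<in> algebra_homs K (URB K R P lam) E"
    "\<And>r. r \<in> carrier R \<Longrightarrow> h (URB_of K R P lam r) = j r" "h (URB_Q K R P lam) = q"
proof -
  obtain h where h: "h \<in> algebra_homs K (free_RB K R) E"
    "\<And>r. r \<in> carrier R \<Longrightarrow> h (free_RB_of K R r) = j r" "h (free_RB_Q K R) = q"
    using free_RB_lift[OF E j q] by blast
  have kill: "h s = \<zero>\<^bsub>E\<^esub>"
    if "s \<in> URB_relator (free_RB K R) (free_RB_of K R) (free_RB_Q K R) P lam ` carrier R" for s
  proof -
    from that obtain r where r: "r \<in> carrier R"
      and s: "s = URB_relator (free_RB K R) (free_RB_of K R) (free_RB_Q K R) P lam r" by blast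
    have "h s = URB_relator E j q P lam r"
      using algebra_homs_URB_relator[OF h(1) free_RB_unital_algebra E free_RB_Q_closed _ _ weight,
        where i = "free_RB_of K R" and r = r] algebra_homs_closed[OF free_RB_of_hom] r P_closed
      by (simp add: s URB_relator_def h)
    then show ?thesis by (simp add: rel r)
  qed
  obtain g where g: "g \<in> algebra_homs K (URB K R P lam) E"
    "\<And>x. x \<in> carrier (free_RB K R) \<Longrightarrow> g (URB_ideal K R P lam +>\<^bsub>free_RB K R\<^esub> x) = h x"
    using unital_algebra.quot_algebra_lift[OF free_RB_unital_algebra E h(1) URB_relators_closed kill]
    unfolding URB_def URB_ideal_eq by blast
  show thesis
    by (rule that[OF g(1)])
      (simp_all add: URB_of_def URB_Q_def g(2) h algebra_homs_closed[OF free_RB_of_hom] free_RB_Q_closed)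
qed

text \<open>Generators of \<open>free_RB\<close> stay generators in the quotient. The rule takes the
  place of uniqueness in the universal property: it shows that actions are determined by
  \<open>R\<close> and \<open>Q\<close>, and that additive maps compatible with these are linear
  over \<open>URB\<close>.\<close>

lemma URB_induct [consumes 1, case_names of_elem Q add mult]:
  assumes x: "x \<in> carrier (URB K R P lam)"
    and of_elem: "\<And>r. r \<in> carrier R \<Longrightarrow> S (URB_of K R P lam r)"
    and Q: "S (URB_Q K R P lam)"
    and add: "\<And>x y. \<lbrakk>x \<in> carrier (URB K R P lam); y \<in> carrier (URB K R P lam); S x; S y\<rbrakk> \<Longrightarrow>
      S (x \<oplus>\<^bsub>URB K R P lam\<^esub> y)"
    and mult: "\<And>x y. \<lbrakk>x \<in> carrier (URB K R P lam); y \<in> carrier (URB K R P lam); S x; S y\<rbrakk> \<Longrightarrow>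
      S (x \<otimes>\<^bsub>URB K R P lam\<^esub> y)"
  shows "S x"
proof -
  note \<pi> = URB_proj
  have "S (URB_ideal K R P lam +>\<^bsub>free_RB K R\<^esub> f)" if "f \<in> carrier (free_RB K R)" for f
    using that
  proof (induction rule: free_RB_induct)
    case (of_elem r)
    then show ?case using assms(2) by (simp add: URB_of_def)
  next
    case Q
    show ?case using assms(3) by (simp add: URB_Q_def)
  next
    case (add f g)
    then show ?case using assms(4) by (simp add: algebra_homs_add[OF \<pi>] algebra_homs_closed[OF \<pi>])
  next
    case (mult f g)
    then show ?case using assms(5) by (simp add: algebra_homs_mult[OF \<pi>] algebra_homs_closed[OF \<pi>])
  qed
  moreover obtain f where "f \<in> carrier (free_RB K R)" "x = URB_ideal K R P lam +>\<^bsub>free_RB K R\<^esub> f"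
    using x by (auto simp: URB_def quot_algebra_carrier)
  ultimately show ?thesis by simp
qed

end

section \<open>Modules and endomorphism algebras\<close>

lemma module_homsI:
  assumes "f \<in> carrier M \<rightarrow>\<^sub>E carrier N"
    and "\<And>x y. \<lbrakk>x \<in> carrier M; y \<in> carrier M\<rbrakk> \<Longrightarrow> f (x \<oplus>\<^bsub>M\<^esub> y) = f x \<oplus>\<^bsub>N\<^esub> f y"
    and "\<And>a x. \<lbrakk>a \<in> carrier A; x \<in> carrier M\<rbrakk> \<Longrightarrow> f (a \<odot>\<^bsub>M\<^esub> x) = a \<odot>\<^bsub>N\<^esub> f x"
  shows "f \<in> module_homs A M N"
  using assms by (simp add: module_homs_def)

lemma
  assumes "f \<in> module_homs A M N"
  shows module_homs_funcset: "f \<in> carrier M \<rightarrow>\<^sub>E carrier N"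
    and module_homs_closed: "x \<in> carrier M \<Longrightarrow> f x \<in> carrier N"
    and module_homs_add: "\<lbrakk>x \<in> carrier M; y \<in> carrier M\<rbrakk> \<Longrightarrow> f (x \<oplus>\<^bsub>M\<^esub> y) = f x \<oplus>\<^bsub>N\<^esub> f y"
    and module_homs_smult: "\<lbrakk>a \<in> carrier A; x \<in> carrier M\<rbrakk> \<Longrightarrow> f (a \<odot>\<^bsub>M\<^esub> x) = a \<odot>\<^bsub>N\<^esub> f x"
  using assms by (auto simp: module_homs_def)

lemma module_homs_eqI:
  assumes "f \<in> module_homs A M N" "g \<in> module_homs A M N" "\<And>x. x \<in> carrier M \<Longrightarrow> f x = g x"
  shows "f = g"
  by (rule PiE_ext[OF module_homs_funcset[OF assms(1)] module_homs_funcset[OF assms(2)] assms(3)])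

lemma module_with_simps:
  "carrier (module_with S M act) = carrier M"
  "\<zero>\<^bsub>module_with S M act\<^esub> = \<zero>\<^bsub>M\<^esub>"
  "\<lbrakk>x \<in> carrier M; y \<in> carrier M\<rbrakk> \<Longrightarrow> x \<oplus>\<^bsub>module_with S M act\<^esub> y = x \<oplus>\<^bsub>M\<^esub> y"
  "\<lbrakk>a \<in> S; x \<in> carrier M\<rbrakk> \<Longrightarrow> a \<odot>\<^bsub>module_with S M act\<^esub> x = act a x"
  by (simp_all add: module_with_def)

lemma abelian_group_module_with:
  assumes "abelian_group M" shows "abelian_group (module_with S M act)"
proof -
  interpret M: abelian_group M by fact
  show ?thesis
  proof (rule abelian_groupI)
    fix x assume x: "x \<in> carrier (module_with S M act)"
    show "\<exists>y\<in>carrier (module_with S M act). y \<oplus>\<^bsub>module_with S M act\<^esub> x = \<zero>\<^bsub>module_with S M act\<^esub>"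
      by (rule bexI[of _ "\<ominus>\<^bsub>M\<^esub> x"]) (use x in \<open>simp_all add: module_with_simps M.l_neg\<close>)
  qed (simp_all add: module_with_simps M.a_assoc, simp add: M.a_comm)
qed

lemma left_module_module_withI:
  assumes "ring A" and "abelian_group M"
    and closed: "\<And>a x. \<lbrakk>a \<in> carrier A; x \<in> carrier M\<rbrakk> \<Longrightarrow> act a x \<in> carrier M"
    and "\<And>a b x. \<lbrakk>a \<in> carrier A; b \<in> carrier A; x \<in> carrier M\<rbrakk> \<Longrightarrow> act (a \<oplus>\<^bsub>A\<^esub> b) x = act a x \<oplus>\<^bsub>M\<^esub> act b x"
    and "\<And>a x y. \<lbrakk>a \<in> carrier A; x \<in> carrier M; y \<in> carrier M\<rbrakk> \<Longrightarrow> act a (x \<oplus>\<^bsub>M\<^esub> y) = act a x \<oplus>\<^bsub>M\<^esub> act a y"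
    and "\<And>a b x. \<lbrakk>a \<in> carrier A; b \<in> carrier A; x \<in> carrier M\<rbrakk> \<Longrightarrow> act (a \<otimes>\<^bsub>A\<^esub> b) x = act a (act b x)"
    and "\<And>x. x \<in> carrier M \<Longrightarrow> act \<one>\<^bsub>A\<^esub> x = x"
  shows "left_module A (module_with (carrier A) M act)"
proof -
  interpret A: ring A by fact
  interpret M: abelian_group M by fact
  show ?thesis
    by (intro left_module.intro abelian_group_module_with assms(1,2) left_module_axioms.intro)
      (simp_all add: module_with_simps assms closed)
qed

lemma
  assumes "left_module A (module_with (carrier A) M act)"
  shows left_module_with_closed: "\<lbrakk>a \<in> carrier A; x \<in> carrier M\<rbrakk> \<Longrightarrow> act a x \<in> carrier M"
    and left_module_with_l_distr: "\<lbrakk>a \<in> carrier A; b \<in> carrier A; x \<in> carrier M\<rbrakk> \<Longrightarrow>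
      act (a \<oplus>\<^bsub>A\<^esub> b) x = act a x \<oplus>\<^bsub>M\<^esub> act b x"
    and left_module_with_assoc: "\<lbrakk>a \<in> carrier A; b \<in> carrier A; x \<in> carrier M\<rbrakk> \<Longrightarrow>
      act (a \<otimes>\<^bsub>A\<^esub> b) x = act a (act b x)"
proof -
  interpret N: left_module A "module_with (carrier A) M act" by fact
  show closed: "act a x \<in> carrier M" if "a \<in> carrier A" "x \<in> carrier M" for a x
    using N.smult_closed[of a x] that by (simp add: module_with_simps)
  show "act (a \<oplus>\<^bsub>A\<^esub> b) x = act a x \<oplus>\<^bsub>M\<^esub> act b x"
    if "a \<in> carrier A" "b \<in> carrier A" "x \<in> carrier M"
    using N.smult_l_distr[of a b x] that by (simp add: module_with_simps closed)
  show "act (a \<otimes>\<^bsub>A\<^esub> b) x = act a (act b x)"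
    if "a \<in> carrier A" "b \<in> carrier A" "x \<in> carrier M"
    using N.smult_assoc[of a b x] that by (simp add: module_with_simps closed)
qed

text \<open>Elements are extensional functions, and all operations return such functions, so that
  identities between endomorphisms can be checked pointwise on the carrier.\<close>

definition endo_algebra :: "('k, 's) ring_scheme \<Rightarrow> ('k, 'm, 't) module_scheme \<Rightarrow> ('k, 'm \<Rightarrow> 'm) module" where
  "endo_algebra K M =
    \<lparr>carrier = module_homs K M M,
     mult = (\<lambda>f g. compose (carrier M) f g),
     one = (\<lambda>x\<in>carrier M. x),
     zero = (\<lambda>x\<in>carrier M. \<zero>\<^bsub>M\<^esub>),
     add = (\<lambda>f g. \<lambda>x\<in>carrier M. f x \<oplus>\<^bsub>M\<^esub> g x),
     smult = (\<lambda>c f. \<lambda>x\<in>carrier M. c \<odot>\<^bsub>M\<^esub> f x)\<rparr>"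

lemma endo_algebra_simps:
  "carrier (endo_algebra K M) = module_homs K M M"
  "f \<otimes>\<^bsub>endo_algebra K M\<^esub> g = compose (carrier M) f g"
  "\<one>\<^bsub>endo_algebra K M\<^esub> = (\<lambda>x\<in>carrier M. x)"
  "\<zero>\<^bsub>endo_algebra K M\<^esub> = (\<lambda>x\<in>carrier M. \<zero>\<^bsub>M\<^esub>)"
  "f \<oplus>\<^bsub>endo_algebra K M\<^esub> g = (\<lambda>x\<in>carrier M. f x \<oplus>\<^bsub>M\<^esub> g x)"
  "c \<odot>\<^bsub>endo_algebra K M\<^esub> f = (\<lambda>x\<in>carrier M. c \<odot>\<^bsub>M\<^esub> f x)"
  by (simp_all add: endo_algebra_def)

lemma module_homs_id:
  assumes "\<And>x y. \<lbrakk>x \<in> carrier L; y \<in> carrier L\<rbrakk> \<Longrightarrow> x \<oplus>\<^bsub>L\<^esub> y \<in> carrier L"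
    and "\<And>a x. \<lbrakk>a \<in> carrier A; x \<in> carrier L\<rbrakk> \<Longrightarrow> a \<odot>\<^bsub>L\<^esub> x \<in> carrier L"
  shows "(\<lambda>x\<in>carrier L. x) \<in> module_homs A L L"
  by (rule module_homsI) (simp_all add: assms)

lemma module_homs_compose:
  assumes f: "f \<in> module_homs A L M" and g: "g \<in> module_homs A M N"
    and L: "\<And>x y. \<lbrakk>x \<in> carrier L; y \<in> carrier L\<rbrakk> \<Longrightarrow> x \<oplus>\<^bsub>L\<^esub> y \<in> carrier L"
      "\<And>a x. \<lbrakk>a \<in> carrier A; x \<in> carrier L\<rbrakk> \<Longrightarrow> a \<odot>\<^bsub>L\<^esub> x \<in> carrier L"
  shows "compose (carrier L) g f \<in> module_homs A L N"
  by (rule module_homsI)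
    (simp_all add: compose_def L module_homs_closed[OF f] module_homs_closed[OF g]
      module_homs_add[OF f] module_homs_add[OF g] module_homs_smult[OF f] module_homs_smult[OF g])

section \<open>Endomorphisms of a module over a commutative ring\<close>

context Module.module
begin

lemma endo_algebra_closed:
  shows "f \<in> module_homs R M M \<Longrightarrow> g \<in> module_homs R M M \<Longrightarrow>
      f \<oplus>\<^bsub>endo_algebra R M\<^esub> g \<in> module_homs R M M"
    and "f \<in> module_homs R M M \<Longrightarrow> g \<in> module_homs R M M \<Longrightarrow>
      f \<otimes>\<^bsub>endo_algebra R M\<^esub> g \<in> module_homs R M M"
    and "\<zero>\<^bsub>endo_algebra R M\<^esub> \<in> module_homs R M M"
    and "\<one>\<^bsub>endo_algebra R M\<^esub> \<in> module_homs R M M"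
    and "c \<in> carrier R \<Longrightarrow> f \<in> module_homs R M M \<Longrightarrow> c \<odot>\<^bsub>endo_algebra R M\<^esub> f \<in> module_homs R M M"
proof -
  show "f \<oplus>\<^bsub>endo_algebra R M\<^esub> g \<in> module_homs R M M"
    if f: "f \<in> module_homs R M M" and g: "g \<in> module_homs R M M"
    by (rule module_homsI)
      (simp_all add: endo_algebra_simps module_homs_closed[OF f] module_homs_closed[OF g]
        module_homs_add[OF f] module_homs_add[OF g] module_homs_smult[OF f] module_homs_smult[OF g]
        M.a_ac smult_r_distr)
  show "f \<otimes>\<^bsub>endo_algebra R M\<^esub> g \<in> module_homs R M M"
    if "f \<in> module_homs R M M" "g \<in> module_homs R M M"
    unfolding endo_algebra_simps by (rule module_homs_compose[OF that(2,1)]) simp_all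
  show "\<zero>\<^bsub>endo_algebra R M\<^esub> \<in> module_homs R M M"
    by (rule module_homsI) (simp_all add: endo_algebra_simps)
  show "\<one>\<^bsub>endo_algebra R M\<^esub> \<in> module_homs R M M"
    by (simp add: endo_algebra_simps module_homs_id)
  show "c \<odot>\<^bsub>endo_algebra R M\<^esub> f \<in> module_homs R M M"
    if c: "c \<in> carrier R" and f: "f \<in> module_homs R M M"
  proof (rule module_homsI)
    fix a x assume a: "a \<in> carrier R" and x: "x \<in> carrier M"
    \<comment> \<open>Commutativity of the base ring is what makes a scalar multiple of a linear map
      linear again.\<close>
    have "c \<odot>\<^bsub>M\<^esub> (a \<odot>\<^bsub>M\<^esub> f x) = a \<odot>\<^bsub>M\<^esub> (c \<odot>\<^bsub>M\<^esub> f x)"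
      using a c x by (simp add: smult_assoc1[symmetric] module_homs_closed[OF f] R.m_comm)
    then show "(c \<odot>\<^bsub>endo_algebra R M\<^esub> f) (a \<odot>\<^bsub>M\<^esub> x) = a \<odot>\<^bsub>M\<^esub> (c \<odot>\<^bsub>endo_algebra R M\<^esub> f) x"
      using a c x by (simp add: endo_algebra_simps module_homs_smult[OF f])
  qed (use c in \<open>simp_all add: endo_algebra_simps module_homs_closed[OF f] module_homs_add[OF f] smult_r_distr\<close>)
qed

lemma endo_algebra_unital_algebra: "unital_algebra R (endo_algebra R M)"
proof -
  let ?E = "endo_algebra R M"
  note closed = endo_algebra_closed
  note apply_simps = endo_algebra_simps compose_def
  have hom: "f x \<in> carrier M" "f (x \<oplus>\<^bsub>M\<^esub> y) = f x \<oplus>\<^bsub>M\<^esub> f y" "c \<in> carrier R \<Longrightarrow> f (c \<odot>\<^bsub>M\<^esub> x) = c \<odot>\<^bsub>M\<^esub> f x"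
    if "f \<in> module_homs R M M" "x \<in> carrier M" "y \<in> carrier M" for f x y c
    using that module_homs_closed module_homs_add module_homs_smult by metis+
  have carrier: "carrier ?E = module_homs R M M" by (simp add: endo_algebra_simps)
  have abelian: "abelian_group ?E"
  proof (rule abelian_groupI, unfold carrier)
    fix f assume f: "f \<in> module_homs R M M"
    have "(\<ominus> \<one>) \<odot>\<^bsub>?E\<^esub> f \<oplus>\<^bsub>?E\<^esub> f = \<zero>\<^bsub>?E\<^esub>"
      by (rule module_homs_eqI[of _ R M M]) (use f in \<open>simp_all add: closed\<close>,
        simp add: apply_simps hom smult_l_minus M.l_neg)
    then show "\<exists>g\<in>module_homs R M M. g \<oplus>\<^bsub>?E\<^esub> f = \<zero>\<^bsub>?E\<^esub>"
      using f by (intro bexI[of _ "(\<ominus> \<one>) \<odot>\<^bsub>?E\<^esub> f"]) (simp_all add: closed)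
  next
    fix f g assume f: "f \<in> module_homs R M M" and g: "g \<in> module_homs R M M"
    show "f \<oplus>\<^bsub>?E\<^esub> g \<in> module_homs R M M" using f g by (rule closed)
    show "f \<oplus>\<^bsub>?E\<^esub> g = g \<oplus>\<^bsub>?E\<^esub> f"
      by (rule module_homs_eqI[of _ R M M]) (use f g in \<open>simp_all add: closed\<close>,
        simp add: apply_simps hom M.a_comm)
    fix h assume h: "h \<in> module_homs R M M"
    show "f \<oplus>\<^bsub>?E\<^esub> g \<oplus>\<^bsub>?E\<^esub> h = f \<oplus>\<^bsub>?E\<^esub> (g \<oplus>\<^bsub>?E\<^esub> h)"
      by (rule module_homs_eqI[of _ R M M]) (use f g h in \<open>simp_all add: closed\<close>,
        simp add: apply_simps hom M.a_assoc)
  next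
    fix f assume f: "f \<in> module_homs R M M"
    show "\<zero>\<^bsub>?E\<^esub> \<oplus>\<^bsub>?E\<^esub> f = f"
      by (rule module_homs_eqI[of _ R M M]) (use f in \<open>simp_all add: closed\<close>,
        simp add: apply_simps hom)
  qed (rule closed)
  have monoid: "Group.monoid ?E"
  proof (rule monoidI, unfold carrier)
    fix f g h assume f: "f \<in> module_homs R M M" and g: "g \<in> module_homs R M M" and h: "h \<in> module_homs R M M"
    show "f \<otimes>\<^bsub>?E\<^esub> g \<otimes>\<^bsub>?E\<^esub> h = f \<otimes>\<^bsub>?E\<^esub> (g \<otimes>\<^bsub>?E\<^esub> h)"
      by (rule module_homs_eqI[of _ R M M]) (use f g h in \<open>simp_all add: closed\<close>,
        simp add: apply_simps hom)
  next
    fix f assume f: "f \<in> module_homs R M M"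
    show "\<one>\<^bsub>?E\<^esub> \<otimes>\<^bsub>?E\<^esub> f = f"
      by (rule module_homs_eqI[of _ R M M]) (use f in \<open>simp_all add: closed\<close>,
        simp add: apply_simps hom)
    show "f \<otimes>\<^bsub>?E\<^esub> \<one>\<^bsub>?E\<^esub> = f"
      by (rule module_homs_eqI[of _ R M M]) (use f in \<open>simp_all add: closed\<close>,
        simp add: apply_simps hom)
  qed (simp_all add: closed)
  have ring: "ring ?E"
  proof (rule ringI[OF abelian monoid], unfold carrier)
    fix f g h assume f: "f \<in> module_homs R M M" and g: "g \<in> module_homs R M M" and h: "h \<in> module_homs R M M"
    show "(f \<oplus>\<^bsub>?E\<^esub> g) \<otimes>\<^bsub>?E\<^esub> h = f \<otimes>\<^bsub>?E\<^esub> h \<oplus>\<^bsub>?E\<^esub> g \<otimes>\<^bsub>?E\<^esub> h"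
      by (rule module_homs_eqI[of _ R M M]) (use f g h in \<open>simp_all add: closed\<close>,
        simp add: apply_simps hom)
    show "h \<otimes>\<^bsub>?E\<^esub> (f \<oplus>\<^bsub>?E\<^esub> g) = h \<otimes>\<^bsub>?E\<^esub> f \<oplus>\<^bsub>?E\<^esub> h \<otimes>\<^bsub>?E\<^esub> g"
      by (rule module_homs_eqI[of _ R M M]) (use f g h in \<open>simp_all add: closed\<close>,
        simp add: apply_simps hom)
  qed
  have "Module.module R ?E"
  proof (rule moduleI[OF is_cring abelian], unfold carrier)
    fix a b f g assume a: "a \<in> carrier R" and b: "b \<in> carrier R"
      and f: "f \<in> module_homs R M M" and g: "g \<in> module_homs R M M"
    show "a \<odot>\<^bsub>?E\<^esub> f \<in> module_homs R M M" using a f by (rule closed)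
    show "(a \<oplus> b) \<odot>\<^bsub>?E\<^esub> f = a \<odot>\<^bsub>?E\<^esub> f \<oplus>\<^bsub>?E\<^esub> b \<odot>\<^bsub>?E\<^esub> f"
      by (rule module_homs_eqI[of _ R M M]) (use a b f in \<open>simp_all add: closed\<close>,
        simp add: apply_simps hom smult_l_distr)
    show "a \<odot>\<^bsub>?E\<^esub> (f \<oplus>\<^bsub>?E\<^esub> g) = a \<odot>\<^bsub>?E\<^esub> f \<oplus>\<^bsub>?E\<^esub> a \<odot>\<^bsub>?E\<^esub> g"
      by (rule module_homs_eqI[of _ R M M]) (use a f g in \<open>simp_all add: closed\<close>,
        simp add: apply_simps hom smult_r_distr)
    show "(a \<otimes> b) \<odot>\<^bsub>?E\<^esub> f = a \<odot>\<^bsub>?E\<^esub> (b \<odot>\<^bsub>?E\<^esub> f)"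
      by (rule module_homs_eqI[of _ R M M]) (use a b f in \<open>simp_all add: closed\<close>,
        simp add: apply_simps hom smult_assoc1)
  next
    fix f assume f: "f \<in> module_homs R M M"
    show "\<one> \<odot>\<^bsub>?E\<^esub> f = f"
      by (rule module_homs_eqI[of _ R M M]) (use f in \<open>simp_all add: closed\<close>,
        simp add: apply_simps hom)
  qed
  moreover have "unital_algebra_axioms R ?E"
  proof (rule unital_algebra_axioms.intro, unfold carrier)
    fix c f g assume c: "c \<in> carrier R" and f: "f \<in> module_homs R M M" and g: "g \<in> module_homs R M M"
    show "(c \<odot>\<^bsub>?E\<^esub> f) \<otimes>\<^bsub>?E\<^esub> g = c \<odot>\<^bsub>?E\<^esub> (f \<otimes>\<^bsub>?E\<^esub> g)"
      by (rule module_homs_eqI[of _ R M M]) (use c f g in \<open>simp_all add: closed\<close>,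
        simp add: apply_simps hom)
    show "f \<otimes>\<^bsub>?E\<^esub> (c \<odot>\<^bsub>?E\<^esub> g) = c \<odot>\<^bsub>?E\<^esub> (f \<otimes>\<^bsub>?E\<^esub> g)"
      by (rule module_homs_eqI[of _ R M M]) (use c f g in \<open>simp_all add: closed\<close>,
        simp add: apply_simps hom)
  qed
  ultimately show ?thesis using ring by (intro unital_algebra.intro)
qed

end

text \<open>A module is a ring homomorphism into endomorphisms: additivity of each
  \<open>h a\<close> gives one distributive law, and compatibility of \<open>h\<close> with sums,
  products and one gives the other laws. This turns a lift from the universal property into an
  action.\<close>

lemma endo_algebra_left_module:
  assumes "ring U" and "abelian_group M" and h: "h \<in> ring_hom U (endo_algebra K (module_with S M sm))"
  shows "left_module U (module_with (carrier U) M h)"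
proof -
  interpret U: ring U by fact
  interpret M: abelian_group M by fact
  have hom: "h a \<in> module_homs K (module_with S M sm) (module_with S M sm)" if "a \<in> carrier U" for a
    using ring_hom_closed[OF h that] by (simp add: endo_algebra_simps)
  show ?thesis
  proof (rule left_module_module_withI[OF assms(1,2)])
    show closed: "h a x \<in> carrier M" if "a \<in> carrier U" "x \<in> carrier M" for a x
      using module_homs_closed[OF hom[OF that(1)], of x] that by (simp add: module_with_simps)
    show "h (a \<oplus>\<^bsub>U\<^esub> b) x = h a x \<oplus>\<^bsub>M\<^esub> h b x"
      if "a \<in> carrier U" "b \<in> carrier U" "x \<in> carrier M" for a b x
      using that closed by (simp add: ring_hom_add[OF h] endo_algebra_simps module_with_simps)
    show "h a (x \<oplus>\<^bsub>M\<^esub> y) = h a x \<oplus>\<^bsub>M\<^esub> h a y"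
      if "a \<in> carrier U" "x \<in> carrier M" "y \<in> carrier M" for a x y
      using module_homs_add[OF hom[OF that(1)], of x y] that closed by (simp add: module_with_simps)
    show "h (a \<otimes>\<^bsub>U\<^esub> b) x = h a (h b x)"
      if "a \<in> carrier U" "b \<in> carrier U" "x \<in> carrier M" for a b x
      using that by (simp add: ring_hom_mult[OF h] endo_algebra_simps module_with_simps compose_def)
    show "h \<one>\<^bsub>U\<^esub> x = x" if "x \<in> carrier M" for x
      using that by (simp add: ring_hom_one[OF h] endo_algebra_simps module_with_simps)
  qed
qed

section \<open>Rota-Baxter modules as modules over the ring of Rota-Baxter operators\<close>

lemma module_with_cong:
  assumes "\<And>a x. \<lbrakk>a \<in> S; x \<in> carrier M\<rbrakk> \<Longrightarrow> act a x = act' a x"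
  shows "module_with S M act = module_with S M act'"
  using assms by (auto simp: module_with_def restrict_def fun_eq_iff)

text \<open>Rebuilding forgets the earlier action, which is why extension and restriction can cancel
  on the nose.\<close>

lemma module_with_module_with: "module_with S (module_with T M act') act = module_with S M act"
  by (auto simp: module_with_def restrict_def fun_eq_iff)

section \<open>Rota-Baxter operators and actions of the operator ring on one module\<close>

context rota_baxter_algebra
begin

abbreviation "U \<equiv> URB K R P lam"
abbreviation "\<iota> \<equiv> URB_of K R P lam"
abbreviation "Q \<equiv> URB_Q K R P lam"

interpretation U: unital_algebra K U by (rule URB_unital_algebra)

lemma \<iota>_closed: "r \<in> carrier R \<Longrightarrow> \<iota> r \<in> carrier U"
  by (rule algebra_homs_closed[OF URB_of_hom])

lemma URB_relation_eq:
  assumes "r \<in> carrier R"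
  shows "\<iota> (P r) \<otimes>\<^bsub>U\<^esub> Q = (Q \<otimes>\<^bsub>U\<^esub> \<iota> r \<otimes>\<^bsub>U\<^esub> Q) \<oplus>\<^bsub>U\<^esub> (Q \<otimes>\<^bsub>U\<^esub> \<iota> (P r)) \<oplus>\<^bsub>U\<^esub> (lam \<odot>\<^bsub>U\<^esub> (Q \<otimes>\<^bsub>U\<^esub> \<iota> r))"
  using URB_relation[OF assms]
    U.URB_relator_eq_zero_iff[where i = \<iota> and r = r and P = P, OF URB_Q_closed \<iota>_closed[OF assms] _ weight]
    \<iota>_closed[OF P_closed[OF assms]] by simp

text \<open>This is restriction of scalars along \<open>K \<rightarrow> R\<close>, packaged as a
  record so that \<open>endo_algebra\<close> over \<open>K\<close> can be formed for a module given
  over \<open>R\<close>.\<close>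

lemma base_module:
  assumes "left_module R M"
  shows "Module.module K (module_with (carrier K) M (base_smult R M))"
proof -
  interpret M: left_module R M by fact
  show ?thesis
  proof (rule moduleI[OF is_cring abelian_group_module_with[OF M.M.abelian_group_axioms]])
    fix a b x assume "a \<in> carrier K" "b \<in> carrier K" "x \<in> carrier (module_with (carrier K) M (base_smult R M))"
    then show "(a \<otimes> b) \<odot>\<^bsub>module_with (carrier K) M (base_smult R M)\<^esub> x =
        a \<odot>\<^bsub>module_with (carrier K) M (base_smult R M)\<^esub> (b \<odot>\<^bsub>module_with (carrier K) M (base_smult R M)\<^esub> x)"
      by (simp add: module_with_simps base_smult_def M.smult_closed M.smult_assoc[symmetric]
        smult_mult_left smult_assoc1)
  qed (simp_all add: module_with_simps base_smult_def M.smult_closed M.smult_one smult_l_distr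
    M.smult_l_distr M.smult_r_distr)
qed

text \<open>The action of \<open>R\<close> and the operator \<open>p\<close> are
  \<open>K\<close>-linear endomorphisms of \<open>M\<close>, and the module identity says that the
  relators vanish on them; the universal property then yields an action.\<close>

lemma URB_structure_exists:
  assumes "rota_baxter_module K R P lam M p"
  obtains act where "act \<in> URB_structures K R P lam M" "\<And>x. x \<in> carrier M \<Longrightarrow> act Q x = p x"
proof -
  interpret RM: rota_baxter_module K R P lam M p by fact
  have LM: "left_module R M" by (rule RM.LM.left_module_axioms)
  let ?MK = "module_with (carrier K) M (base_smult R M)"
  let ?E = "endo_algebra K ?MK"
  interpret MK: Module.module K ?MK by (rule base_module[OF LM])
  interpret E: unital_algebra K ?E by (rule MK.endo_algebra_unital_algebra)
  \<comment> \<open>Both maps are cut down to the carrier, since elements of the endomorphism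
    algebra are extensional while \<open>p\<close> may be arbitrary outside it.\<close>
  define j where "j r = (\<lambda>x\<in>carrier M. r \<odot>\<^bsub>M\<^esub> x)" for r
  define q where "q = (\<lambda>x\<in>carrier M. p x)"
  note M_simps = module_with_simps RM.LM.smult_closed RM.p_closed
  have base_closed: "base_smult R M c x \<in> carrier M" if "c \<in> carrier K" "x \<in> carrier M" for c x
    using that by (simp add: base_smult_def RM.LM.smult_closed)
  \<comment> \<open>Scalars act through \<open>c \<odot> \<one>\<close>, which is central in
    \<open>R\<close>, so every element of \<open>R\<close> acts linearly over
    \<open>K\<close>.\<close>
  have base_commute: "r \<odot>\<^bsub>M\<^esub> base_smult R M c x = base_smult R M c (r \<odot>\<^bsub>M\<^esub> x)"
    "(c \<odot>\<^bsub>R\<^esub> r) \<odot>\<^bsub>M\<^esub> x = base_smult R M c (r \<odot>\<^bsub>M\<^esub> x)"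
    if "r \<in> carrier R" "c \<in> carrier K" "x \<in> carrier M" for r c x
    using that by (simp_all add: base_smult_def RM.LM.smult_assoc[symmetric] smult_mult_left smult_mult_right)
  have jE: "j r \<in> module_homs K ?MK ?MK" if r: "r \<in> carrier R" for r
    by (rule module_homsI)
      (use r in \<open>simp_all add: j_def M_simps base_closed base_commute RM.LM.smult_r_distr\<close>)
  have qE: "q \<in> module_homs K ?MK ?MK"
    by (rule module_homsI) (simp_all add: q_def M_simps base_closed RM.p_add RM.p_smult)
  have j: "j \<in> algebra_homs K R ?E"
  proof (rule algebra_homsI)
    fix a assume a: "a \<in> carrier R"
    then show "j a \<in> carrier ?E" by (simp add: endo_algebra_simps jE)
    show "j (c \<odot>\<^bsub>R\<^esub> a) = c \<odot>\<^bsub>?E\<^esub> j a" if "c \<in> carrier K" for c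
      using that a by (auto simp: j_def endo_algebra_simps M_simps base_commute fun_eq_iff)
    fix b assume b: "b \<in> carrier R"
    show "j (a \<otimes>\<^bsub>R\<^esub> b) = j a \<otimes>\<^bsub>?E\<^esub> j b"
      using a b by (auto simp: j_def endo_algebra_simps M_simps RM.LM.smult_assoc compose_def fun_eq_iff)
    show "j (a \<oplus>\<^bsub>R\<^esub> b) = j a \<oplus>\<^bsub>?E\<^esub> j b"
      using a b by (auto simp: j_def endo_algebra_simps M_simps RM.LM.smult_l_distr fun_eq_iff)
  next
    show "j \<one>\<^bsub>R\<^esub> = \<one>\<^bsub>?E\<^esub>"
      by (auto simp: j_def endo_algebra_simps M_simps RM.LM.smult_one fun_eq_iff)
  qed
  have rel: "URB_relator ?E j q P lam r = \<zero>\<^bsub>?E\<^esub>" if r: "r \<in> carrier R" for r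
  proof -
    \<comment> \<open>Evaluated at a vector, this equation of endomorphisms is
      \<open>rota_baxter_mod\<close>.\<close>
    have "j (P r) \<otimes>\<^bsub>?E\<^esub> q =
        (q \<otimes>\<^bsub>?E\<^esub> j r \<otimes>\<^bsub>?E\<^esub> q) \<oplus>\<^bsub>?E\<^esub> (q \<otimes>\<^bsub>?E\<^esub> j (P r)) \<oplus>\<^bsub>?E\<^esub> (lam \<odot>\<^bsub>?E\<^esub> (q \<otimes>\<^bsub>?E\<^esub> j r))"
      using r weight by (auto simp: endo_algebra_simps M_simps base_closed j_def q_def P_closed
        RM.rota_baxter_mod compose_def fun_eq_iff)
    then show ?thesis
      using r weight by (subst E.URB_relator_eq_zero_iff) (simp_all add: endo_algebra_simps(1) jE qE P_closed)
  qed
  obtain h where h: "h \<in> algebra_homs K U ?E" "\<And>r. r \<in> carrier R \<Longrightarrow> h (\<iota> r) = j r" "h Q = q"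
    using URB_lift[OF E.unital_algebra_axioms j _ rel] qE unfolding endo_algebra_simps(1) by blast
  \<comment> \<open>\<open>h\<close> is unspecified outside the carrier of \<open>URB\<close>, while
    structures are extensional there as well.\<close>
  let ?act = "restrict h (carrier U)"
  show thesis
  proof (rule that[of ?act])
    have "left_module U (module_with (carrier U) M h)"
      by (rule endo_algebra_left_module[OF U.ring_axioms RM.LM.M.abelian_group_axioms
        algebra_homs_ring_hom[OF h(1)]])
    moreover have "module_with (carrier U) M ?act = module_with (carrier U) M h"
      by (rule module_with_cong) simp
    moreover have "h u \<in> carrier M \<rightarrow>\<^sub>E carrier M" if "u \<in> carrier U" for u
      using module_homs_funcset[of "h u" K ?MK ?MK] algebra_homs_closed[OF h(1) that]
      by (simp add: endo_algebra_simps(1) module_with_simps(1))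
    ultimately show "?act \<in> URB_structures K R P lam M"
      by (simp add: URB_structures_def \<iota>_closed h(2) j_def)
    show "?act Q x = p x" if "x \<in> carrier M" for x
      using that by (simp add: URB_Q_closed h(3) q_def)
  qed
qed

text \<open>The elements on which the two actions coincide are closed under sums and products and
  include \<open>Q\<close> and the image of \<open>R\<close>, hence are all of
  \<open>URB\<close>.\<close>

lemma URB_structure_unique:
  assumes act: "act \<in> URB_structures K R P lam M" and act': "act' \<in> URB_structures K R P lam M"
    and eq: "\<And>x. x \<in> carrier M \<Longrightarrow> act Q x = act' Q x"
  shows "act = act'"
proof -
  have lm: "left_module U (module_with (carrier U) M act)" "left_module U (module_with (carrier U) M act')"
    using act act' by (simp_all add: URB_structures_def)
  note l = left_module_with_closed[OF lm(1)] left_module_with_l_distr[OF lm(1)] left_module_with_assoc[OF lm(1)]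
  note l' = left_module_with_closed[OF lm(2)] left_module_with_l_distr[OF lm(2)] left_module_with_assoc[OF lm(2)]
  have "\<forall>x\<in>carrier M. act u x = act' u x" if "u \<in> carrier U" for u
    using that
  proof (induction rule: URB_induct)
    case (of_elem r)
    then show ?case using act act' by (simp add: URB_structures_def)
  next
    case Q
    show ?case using eq by blast
  next
    case (add u v)
    then show ?case by (simp add: l(2) l'(2))
  next
    case (mult u v)
    then show ?case by (simp add: l(3) l'(1,3))
  qed
  moreover have f: "act \<in> carrier U \<rightarrow>\<^sub>E carrier M \<rightarrow>\<^sub>E carrier M" "act' \<in> carrier U \<rightarrow>\<^sub>E carrier M \<rightarrow>\<^sub>E carrier M"
    using act act' by (simp_all add: URB_structures_def)
  \<comment> \<open>Extensionality is used at two levels: for each \<open>act u\<close> as a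
    function on \<open>M\<close>, then for \<open>act\<close> as a function on
    \<open>URB\<close>.\<close>
  ultimately have "act u = act' u" if "u \<in> carrier U" for u
    using that PiE_mem[OF f(1) that] PiE_mem[OF f(2) that] by (blast intro: PiE_ext)
  with f show ?thesis by (rule PiE_ext)
qed

text \<open>The identity is \<open>URB_relation_eq\<close> applied to a vector. \<open>M\<close> and
  \<open>N\<close> are separate records agreeing on a common carrier, so the result serves both an
  action on a given module and the restriction of a \<open>URB\<close>-module.\<close>

lemma URB_module_rota_baxter:
  assumes N: "left_module U N" and M: "left_module R M" and carrier: "carrier M = carrier N"
    and add: "\<And>x y. \<lbrakk>x \<in> carrier N; y \<in> carrier N\<rbrakk> \<Longrightarrow> x \<oplus>\<^bsub>M\<^esub> y = x \<oplus>\<^bsub>N\<^esub> y"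
    and smult: "\<And>r x. \<lbrakk>r \<in> carrier R; x \<in> carrier N\<rbrakk> \<Longrightarrow> r \<odot>\<^bsub>M\<^esub> x = \<iota> r \<odot>\<^bsub>N\<^esub> x"
    and p: "\<And>x. x \<in> carrier N \<Longrightarrow> p x = Q \<odot>\<^bsub>N\<^esub> x"
  shows "rota_baxter_module K R P lam M p"
proof -
  interpret N: left_module U N by fact
  interpret M: left_module R M by fact
  have base: "base_smult R M c x = c \<odot>\<^bsub>U\<^esub> \<one>\<^bsub>U\<^esub> \<odot>\<^bsub>N\<^esub> x" if "c \<in> carrier K" "x \<in> carrier N" for c x
    using that by (simp add: base_smult_def smult algebra_homs_smult[OF URB_of_hom] algebra_homs_one[OF URB_of_hom])
  note simps = carrier add smult p base \<iota>_closed URB_Q_closed N.smult_closed P_closed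
  have "rota_baxter_module_axioms K R P lam M p"
  proof (rule rota_baxter_module_axioms.intro; unfold carrier)
    fix x assume x: "x \<in> carrier N"
    then show "p x \<in> carrier N" by (simp add: simps)
    show "p (x \<oplus>\<^bsub>M\<^esub> y) = p x \<oplus>\<^bsub>M\<^esub> p y" if "y \<in> carrier N" for y
      using x that by (simp add: simps N.smult_r_distr)
    \<comment> \<open>Scalars act as multiples of one in \<open>URB\<close>, and these commute with
      \<open>Q\<close>.\<close>
    show "p (base_smult R M c x) = base_smult R M c (p x)" if "c \<in> carrier K" for c
      using x that
      by (simp add: simps N.smult_assoc[symmetric] U.smult_mult_left U.smult_mult_right)
    fix a assume a: "a \<in> carrier R"
    have "P a \<odot>\<^bsub>M\<^esub> p x = (\<iota> (P a) \<otimes>\<^bsub>U\<^esub> Q) \<odot>\<^bsub>N\<^esub> x"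
      using a x by (simp add: simps N.smult_assoc)
    also have "\<dots> = (Q \<otimes>\<^bsub>U\<^esub> \<iota> a \<otimes>\<^bsub>U\<^esub> Q) \<odot>\<^bsub>N\<^esub> x \<oplus>\<^bsub>N\<^esub> (Q \<otimes>\<^bsub>U\<^esub> \<iota> (P a)) \<odot>\<^bsub>N\<^esub> x
        \<oplus>\<^bsub>N\<^esub> (lam \<odot>\<^bsub>U\<^esub> (Q \<otimes>\<^bsub>U\<^esub> \<iota> a)) \<odot>\<^bsub>N\<^esub> x"
      using a x weight by (simp add: URB_relation_eq simps N.smult_l_distr)
    also have "(Q \<otimes>\<^bsub>U\<^esub> \<iota> a \<otimes>\<^bsub>U\<^esub> Q) \<odot>\<^bsub>N\<^esub> x = p (a \<odot>\<^bsub>M\<^esub> p x)"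
      using a x by (simp add: simps N.smult_assoc)
    also have "(Q \<otimes>\<^bsub>U\<^esub> \<iota> (P a)) \<odot>\<^bsub>N\<^esub> x = p (P a \<odot>\<^bsub>M\<^esub> x)"
      using a x by (simp add: simps N.smult_assoc)
    also have "(lam \<odot>\<^bsub>U\<^esub> (Q \<otimes>\<^bsub>U\<^esub> \<iota> a)) \<odot>\<^bsub>N\<^esub> x = base_smult R M lam (p (a \<odot>\<^bsub>M\<^esub> x))"
      using a x weight by (simp add: simps N.smult_assoc[symmetric] U.smult_mult_left)
    finally show "P a \<odot>\<^bsub>M\<^esub> p x =
        p (a \<odot>\<^bsub>M\<^esub> p x) \<oplus>\<^bsub>M\<^esub> p (P a \<odot>\<^bsub>M\<^esub> x) \<oplus>\<^bsub>M\<^esub> base_smult R M lam (p (a \<odot>\<^bsub>M\<^esub> x))"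
      using a x weight by (simp add: simps)
  qed
  then show ?thesis
    by (intro rota_baxter_module.intro rota_baxter_algebra_axioms M)
qed

text \<open>Injectivity holds because \<open>R\<close> and \<open>Q\<close> generate, surjectivity
  by the universal property, and the map lands among the operators because of the defining
  relation.\<close>

lemma bij_betw_structures:
  assumes M: "left_module R M"
  shows "bij_betw (\<lambda>act. \<lambda>x\<in>carrier M. act Q x) (URB_structures K R P lam M) (RB_structures K R P lam M)"
proof (rule bij_betwI')
  fix act act' assume act: "act \<in> URB_structures K R P lam M" "act' \<in> URB_structures K R P lam M"
  show "(\<lambda>x\<in>carrier M. act Q x) = (\<lambda>x\<in>carrier M. act' Q x) \<longleftrightarrow> act = act'"
    using URB_structure_unique[OF act] by (metis restrict_apply')
next
  fix act assume act: "act \<in> URB_structures K R P lam M"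
  then have N: "left_module U (module_with (carrier U) M act)"
    by (simp add: URB_structures_def)
  have "rota_baxter_module K R P lam M (\<lambda>x\<in>carrier M. act Q x)"
    by (rule URB_module_rota_baxter[OF N M])
      (use act in \<open>simp_all add: module_with_simps \<iota>_closed URB_Q_closed URB_structures_def\<close>)
  then show "(\<lambda>x\<in>carrier M. act Q x) \<in> RB_structures K R P lam M"
    using left_module_with_closed[OF N URB_Q_closed] by (simp add: RB_structures_def)
next
  fix p assume p: "p \<in> RB_structures K R P lam M"
  then obtain act where act: "act \<in> URB_structures K R P lam M" "\<And>x. x \<in> carrier M \<Longrightarrow> act Q x = p x"
    using URB_structure_exists[of M p] unfolding RB_structures_def by blast
  have "p = (\<lambda>x\<in>carrier M. act Q x)"
    by (rule PiE_ext[of _ "carrier M" "\<lambda>_. carrier M"]) (use p act(2) in \<open>auto simp: RB_structures_def\<close>)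
  with act(1) show "\<exists>act\<in>URB_structures K R P lam M. p = (\<lambda>x\<in>carrier M. act Q x)" by blast
qed

end

section \<open>The isomorphism of categories\<close>

lemma left_module_compose:
  assumes "left_module A L" "f \<in> module_homs A L M" "g \<in> module_homs A M N"
  shows "compose (carrier L) g f \<in> module_homs A L N"
proof -
  interpret L: left_module A L by fact
  show ?thesis by (rule module_homs_compose[OF assms(2,3)]) (simp_all add: L.smult_closed)
qed

lemma left_module_id:
  assumes "left_module A L"
  shows "(\<lambda>x\<in>carrier L. x) \<in> module_homs A L L"
proof -
  interpret L: left_module A L by fact
  show ?thesis by (rule module_homs_id) (simp_all add: L.smult_closed)
qed

lemma compose_id_module_homs:
  assumes "f \<in> module_homs A M N"
  shows "compose (carrier M) f (\<lambda>x\<in>carrier M. x) = f" "compose (carrier M) (\<lambda>x\<in>carrier N. x) f = f"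
  using module_homs_funcset[OF assms] by (auto simp: PiE_iff extensional_def compose_def fun_eq_iff)

lemma category_module_category: "category (module_category A)"
proof (rule category.intro)
  fix W X Y Z f g h
  assume "f \<in> arr (module_category A) W X"
  then have "f \<in> carrier W \<rightarrow> carrier X"
    using module_homs_closed[of f A W X] by (simp add: module_category_def Pi_def)
  then show "compos (module_category A) W X Z (compos (module_category A) X Y Z h g) f =
      compos (module_category A) W Y Z h (compos (module_category A) W X Y g f)"
    by (simp add: module_category_def compose_assoc)
qed (auto simp: module_category_def module_objects_def left_module_id left_module_compose compose_id_module_homs)

lemma category_RB_module_category: "category (RB_module_category K R P lam)"
proof (rule category.intro)
  fix W X Y Z f g h
  assume "f \<in> arr (RB_module_category K R P lam) W X"
  then have "f \<in> carrier (fst W) \<rightarrow> carrier (fst X)"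
    using module_homs_closed[of f R "fst W" "fst X"] by (simp add: RB_module_category_def split_beta Pi_def)
  then show "compos (RB_module_category K R P lam) W X Z (compos (RB_module_category K R P lam) X Y Z h g) f =
      compos (RB_module_category K R P lam) W Y Z h (compos (RB_module_category K R P lam) W X Y g f)"
    by (simp add: RB_module_category_def split_beta compose_assoc)
next
  fix X assume "X \<in> obj (RB_module_category K R P lam)"
  then show "ident (RB_module_category K R P lam) X \<in> arr (RB_module_category K R P lam) X X"
    by (auto simp: RB_module_category_def module_objects_def left_module_id rota_baxter_module.p_closed)
next
  fix X Y Z f g
  assume "X \<in> obj (RB_module_category K R P lam)"
    and f: "f \<in> arr (RB_module_category K R P lam) X Y" and g: "g \<in> arr (RB_module_category K R P lam) Y Z"
  obtain L p M q N r where XYZ: "X = (L, p)" "Y = (M, q)" "Z = (N, r)" by (cases X, cases Y, cases Z)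
  have L: "left_module R L" "\<And>x. x \<in> carrier L \<Longrightarrow> p x \<in> carrier L"
    using \<open>X \<in> _\<close> rota_baxter_module.p_closed[of K R P lam L p]
    by (auto simp: XYZ RB_module_category_def module_objects_def)
  have f: "f \<in> module_homs R L M" "\<And>x. x \<in> carrier L \<Longrightarrow> f (p x) = q (f x)"
    using f by (auto simp: XYZ RB_module_category_def)
  have g: "g \<in> module_homs R M N" "\<And>x. x \<in> carrier M \<Longrightarrow> g (q x) = r (g x)"
    using g by (auto simp: XYZ RB_module_category_def)
  have "compose (carrier L) g f \<in> module_homs R L N"
    by (rule left_module_compose[OF L(1) f(1) g(1)])
  then show "compos (RB_module_category K R P lam) X Y Z g f \<in> arr (RB_module_category K R P lam) X Z"
    using L(2) f(2) g(2) module_homs_closed[OF f(1)]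
    by (simp add: XYZ RB_module_category_def compose_def)
qed (auto simp: RB_module_category_def compose_id_module_homs)

text \<open>Objects are in normal form, so their action is extensional in both arguments; this is
  what lets the action of an object count as an element of \<open>URB_structures\<close>.\<close>

lemma module_objects_smult_funcset:
  assumes "M \<in> module_objects A"
  shows "smult M \<in> carrier A \<rightarrow>\<^sub>E carrier M \<rightarrow>\<^sub>E carrier M"
proof -
  interpret M: left_module A M using assms by (simp add: module_objects_def)
  have "smult (module_with (carrier A) M (smult M)) \<in> carrier A \<rightarrow>\<^sub>E carrier M \<rightarrow>\<^sub>E carrier M"
    by (simp add: module_with_def M.smult_closed)
  then show ?thesis using assms by (simp add: module_objects_def)
qed

section \<open>Restriction and extension between the two categories of modules\<close>

context rota_baxter_algebra
begin

lemma URB_restrict_left_module: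
  assumes N: "left_module U N"
  shows "left_module R (module_with (carrier R) N (\<lambda>r x. \<iota> r \<odot>\<^bsub>N\<^esub> x))"
proof -
  interpret N: left_module U N by fact
  note hom = URB_of_hom
  show ?thesis
    by (rule left_module_module_withI[OF ring_axioms N.M.abelian_group_axioms])
      (simp_all add: \<iota>_closed N.smult_closed algebra_homs_add[OF hom] algebra_homs_mult[OF hom]
        algebra_homs_one[OF hom] N.smult_l_distr N.smult_r_distr N.smult_assoc N.smult_one)
qed

lemma URB_restrict_obj:
  assumes "N \<in> module_objects U"
  shows "URB_restrict K R P lam N \<in> obj (RB_module_category K R P lam)"
proof -
  have N: "left_module U N" using assms by (simp add: module_objects_def)
  let ?M = "module_with (carrier R) N (\<lambda>r x. \<iota> r \<odot>\<^bsub>N\<^esub> x)"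
  have M: "left_module R ?M" by (rule URB_restrict_left_module[OF N])
  have "rota_baxter_module K R P lam ?M (\<lambda>x\<in>carrier N. Q \<odot>\<^bsub>N\<^esub> x)"
    by (rule URB_module_rota_baxter[OF N M]) (simp_all add: module_with_simps)
  moreover have "module_with (carrier R) ?M (smult ?M) = ?M"
    by (auto simp: module_with_def fun_eq_iff)
  ultimately show ?thesis
    using M by (simp add: RB_module_category_def URB_restrict_def module_objects_def module_with_simps(1))
qed

text \<open>Compatibility with \<open>R\<close> and \<open>Q\<close> spreads along
  \<open>URB_induct\<close> to all of \<open>URB\<close>. The hom-sets are thus equal as sets, which
  lets the functor be the identity on arrows.\<close>

lemma URB_restrict_arr:
  assumes M: "M \<in> module_objects U" and N: "N \<in> module_objects U"
  shows "arr (RB_module_category K R P lam) (URB_restrict K R P lam M) (URB_restrict K R P lam N) =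
    module_homs U M N"
proof -
  interpret M: left_module U M using M by (simp add: module_objects_def)
  interpret N: left_module U N using N by (simp add: module_objects_def)
  let ?M = "module_with (carrier R) M (\<lambda>r x. \<iota> r \<odot>\<^bsub>M\<^esub> x)" and ?N = "module_with (carrier R) N (\<lambda>r x. \<iota> r \<odot>\<^bsub>N\<^esub> x)"
  have iff: "f \<in> module_homs R ?M ?N \<and> (\<forall>x\<in>carrier M. f (Q \<odot>\<^bsub>M\<^esub> x) = Q \<odot>\<^bsub>N\<^esub> f x) \<longleftrightarrow> f \<in> module_homs U M N" for f
  proof
    assume f: "f \<in> module_homs U M N"
    have "f \<in> module_homs R ?M ?N"
      by (rule module_homsI)
        (use module_homs_funcset[OF f] module_homs_closed[OF f] in
          \<open>simp_all add: module_with_simps module_homs_add[OF f] module_homs_smult[OF f] \<iota>_closed\<close>)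
    then show "f \<in> module_homs R ?M ?N \<and> (\<forall>x\<in>carrier M. f (Q \<odot>\<^bsub>M\<^esub> x) = Q \<odot>\<^bsub>N\<^esub> f x)"
      by (simp add: module_homs_smult[OF f] URB_Q_closed)
  next
    assume "f \<in> module_homs R ?M ?N \<and> (\<forall>x\<in>carrier M. f (Q \<odot>\<^bsub>M\<^esub> x) = Q \<odot>\<^bsub>N\<^esub> f x)"
    then have f: "f \<in> module_homs R ?M ?N" and fQ: "\<And>x. x \<in> carrier M \<Longrightarrow> f (Q \<odot>\<^bsub>M\<^esub> x) = Q \<odot>\<^bsub>N\<^esub> f x" by auto
    have fc: "f x \<in> carrier N" if "x \<in> carrier M" for x
      using module_homs_closed[OF f, of x] that by (simp add: module_with_simps(1))
    have fadd: "f (x \<oplus>\<^bsub>M\<^esub> y) = f x \<oplus>\<^bsub>N\<^esub> f y" if "x \<in> carrier M" "y \<in> carrier M" for x y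
      using module_homs_add[OF f, of x y] that by (simp add: module_with_simps fc)
    have "\<forall>x\<in>carrier M. f (u \<odot>\<^bsub>M\<^esub> x) = u \<odot>\<^bsub>N\<^esub> f x" if "u \<in> carrier U" for u
      using that
    proof (induction rule: URB_induct)
      case (of_elem r)
      then show ?case using module_homs_smult[OF f of_elem] by (simp add: module_with_simps fc)
    next
      case Q
      show ?case using fQ by blast
    next
      case (add u v)
      then show ?case by (simp add: M.smult_l_distr N.smult_l_distr M.smult_closed fadd fc)
    next
      case (mult u v)
      then show ?case by (simp add: M.smult_assoc N.smult_assoc M.smult_closed fc)
    qed
    moreover have "f \<in> carrier M \<rightarrow>\<^sub>E carrier N"
      using module_homs_funcset[OF f] by (simp add: module_with_simps(1))
    ultimately show "f \<in> module_homs U M N" by (intro module_homsI fadd) auto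
  qed
  have "f \<in> arr (RB_module_category K R P lam) (URB_restrict K R P lam M) (URB_restrict K R P lam N) \<longleftrightarrow>
      f \<in> module_homs U M N" for f
  \<comment> \<open>In the category the operator of the target is restricted to its carrier, so the
    condition on \<open>f\<close> unfolds to the action of \<open>Q\<close> once \<open>f\<close> is
    known to map into that carrier.\<close>
  proof (cases "f \<in> module_homs R ?M ?N")
    case True
    then have "f x \<in> carrier N" if "x \<in> carrier M" for x
      using module_homs_closed[OF True, of x] that by (simp add: module_with_simps(1))
    with True iff[of f] show ?thesis
      by (simp add: RB_module_category_def URB_restrict_def module_with_simps(1))
  next
    case False
    with iff[of f] show ?thesis
      by (simp add: RB_module_category_def URB_restrict_def)
  qed
  then show ?thesis by blast
qed

text \<open>For an object \<open>(M, p)\<close> the chosen preimage is the only structure that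
  induces \<open>p\<close>, so both round trips can be read off from the bijection.\<close>

definition URB_extend :: "('b, 'm) module \<times> ('m \<Rightarrow> 'm) \<Rightarrow> (('a, 'b) free_RB set, 'm) module" where
  "URB_extend = (\<lambda>(M, p). module_with (carrier U) M
     (inv_into (URB_structures K R P lam M) (\<lambda>act. \<lambda>x\<in>carrier M. act Q x) p))"

lemma URB_extend_correct:
  assumes "X \<in> obj (RB_module_category K R P lam)"
  shows "URB_extend X \<in> module_objects U" "URB_restrict K R P lam (URB_extend X) = X"
proof -
  obtain M p where X: "X = (M, p)" by (cases X)
  have M: "left_module R M" "module_with (carrier R) M (smult M) = M"
    and p: "p \<in> extensional (carrier M)" "rota_baxter_module K R P lam M p"
    using assms by (auto simp: X RB_module_category_def module_objects_def)
  have p_RB: "p \<in> RB_structures K R P lam M"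
    using p rota_baxter_module.p_closed[OF p(2)] by (auto simp: RB_structures_def PiE_iff)
  define act where "act = inv_into (URB_structures K R P lam M) (\<lambda>act. \<lambda>x\<in>carrier M. act Q x) p"
  have act: "act \<in> URB_structures K R P lam M" "(\<lambda>x\<in>carrier M. act Q x) = p"
    using inv_into_into[of p "\<lambda>act. \<lambda>x\<in>carrier M. act Q x" "URB_structures K R P lam M"]
      f_inv_into_f[of p "\<lambda>act. \<lambda>x\<in>carrier M. act Q x" "URB_structures K R P lam M"]
      bij_betw_imp_surj_on[OF bij_betw_structures[OF M(1)]] p_RB unfolding act_def by simp_all
  have ext: "URB_extend X = module_with (carrier U) M act"
    by (simp add: X URB_extend_def act_def)
  have "module_with (carrier U) (module_with (carrier U) M act) (smult (module_with (carrier U) M act)) =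
      module_with (carrier U) M act"
    by (auto simp: module_with_def fun_eq_iff)
  then show "URB_extend X \<in> module_objects U"
    using act(1) by (simp add: ext module_objects_def URB_structures_def)
  have "module_with (carrier R) (module_with (carrier U) M act) (\<lambda>r x. \<iota> r \<odot>\<^bsub>module_with (carrier U) M act\<^esub> x) = M"
    unfolding module_with_module_with
    \<comment> \<open>An object equals its own normal form; after replacing \<open>M\<close> by it,
      only the two actions remain to be compared.\<close>
    by (subst (3) M(2)[symmetric], rule module_with_cong)
      (use act(1) in \<open>simp add: module_with_simps \<iota>_closed URB_structures_def\<close>)
  moreover have "(\<lambda>x\<in>carrier (module_with (carrier U) M act). Q \<odot>\<^bsub>module_with (carrier U) M act\<^esub> x) = p"
    unfolding act(2)[symmetric] by (simp add: module_with_simps URB_Q_closed cong: restrict_cong)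
  ultimately show "URB_restrict K R P lam (URB_extend X) = X"
    unfolding ext URB_restrict_def by (simp add: X)
qed

text \<open>The action of \<open>N\<close> is itself a structure on the restricted module and
  induces its operator, so by injectivity it is the chosen preimage; \<open>N\<close> is recovered
  because it is its own normal form.\<close>

lemma URB_extend_restrict:
  assumes N: "N \<in> module_objects U"
  shows "URB_extend (URB_restrict K R P lam N) = N"
proof -
  let ?M = "module_with (carrier R) N (\<lambda>r x. \<iota> r \<odot>\<^bsub>N\<^esub> x)" and ?p = "\<lambda>x\<in>carrier N. Q \<odot>\<^bsub>N\<^esub> x"
  have lm: "left_module U N" and eq: "module_with (carrier U) N (smult N) = N"
    using N by (simp_all add: module_objects_def)
  have "smult N \<in> URB_structures K R P lam ?M"
    using module_objects_smult_funcset[OF N] lm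
    by (simp add: URB_structures_def module_with_module_with eq module_with_simps)
  moreover have "inj_on (\<lambda>act. \<lambda>x\<in>carrier ?M. act Q x) (URB_structures K R P lam ?M)"
    using bij_betw_structures[OF URB_restrict_left_module[OF lm]] by (rule bij_betw_imp_inj_on)
  ultimately have "inv_into (URB_structures K R P lam ?M) (\<lambda>act. \<lambda>x\<in>carrier ?M. act Q x) ?p = smult N"
    using inv_into_f_f[of "\<lambda>act. \<lambda>x\<in>carrier ?M. act Q x" "URB_structures K R P lam ?M" "smult N"]
    by (simp add: module_with_simps(1))
  then show ?thesis
    by (simp add: URB_extend_def URB_restrict_def module_with_module_with eq)
qed

lemma category_isomorphism_URB_restrict:
  "category_isomorphism
    (module_category U :: ((('a, 'b) free_RB set, 'm) module, 'm \<Rightarrow> 'm) category_data)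
    (RB_module_category K R P lam :: (('b, 'm) module \<times> ('m \<Rightarrow> 'm), 'm \<Rightarrow> 'm) category_data)
    (URB_restrict K R P lam) (\<lambda>_ _ f. f)"
    (is "category_isomorphism ?C ?D ?F _")
proof -
  have obj: "obj ?C = module_objects U" and arr: "arr ?C = module_homs U"
    and ident: "ident ?C M = (\<lambda>x\<in>carrier M. x)" and compos: "compos ?C L M N g f = compose (carrier L) g f"
    for L M N f g
    by (simp_all add: module_category_def)
  have ident': "ident ?D X = (\<lambda>x\<in>carrier (fst X). x)"
    and compos': "compos ?D X Y Z g f = compose (carrier (fst X)) g f" for X Y Z f g
    by (simp_all add: RB_module_category_def split_beta)
  have fst: "carrier (fst (?F N)) = carrier N" for N
    by (simp add: URB_restrict_def module_with_simps(1))
  have fst': "carrier (URB_extend X) = carrier (fst X)" for X :: "('b, 'm) module \<times> ('m \<Rightarrow> 'm)"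
    by (simp add: URB_extend_def split_beta module_with_simps(1))
  have "category_functor ?C ?D ?F (\<lambda>_ _ f. f)"
    by (intro category_functor.intro category_functor_axioms.intro
        category_module_category category_RB_module_category)
      (simp_all add: obj arr ident compos ident' compos' fst URB_restrict_obj URB_restrict_arr)
  moreover have "category_functor ?D ?C URB_extend (\<lambda>_ _ f. f)"
  proof (intro category_functor.intro category_functor_axioms.intro
      category_module_category category_RB_module_category)
    fix X Y f assume X: "X \<in> obj ?D" and Y: "Y \<in> obj ?D" and f: "f \<in> arr ?D X Y"
    \<comment> \<open>The equality of hom-sets is taken at the two extensions, whose restrictions
      are \<open>X\<close> and \<open>Y\<close> again.\<close>
    show "f \<in> arr ?C (URB_extend X) (URB_extend Y)"
      using URB_restrict_arr[OF URB_extend_correct(1)[OF X] URB_extend_correct(1)[OF Y]] f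
      by (simp add: arr URB_extend_correct(2) X Y)
  qed (simp_all add: obj ident compos ident' compos' fst' URB_extend_correct(1))
  ultimately show ?thesis
    unfolding category_isomorphism_def obj
    by (intro conjI exI[of _ URB_extend] exI[of _ "\<lambda>_ _ f. f"])
      (simp_all add: URB_extend_correct(2) URB_extend_restrict)
qed

end

theorem theorem3p3:
  fixes K :: "('k, 's) ring_scheme"
    and R :: "('k, 'r, 't) module_scheme"
    and P :: "'r \<Rightarrow> 'r"
    and lam :: 'k
  assumes "rota_baxter_algebra K R P lam"
  shows "(\<forall>M :: ('r, 'm) module. left_module R M \<longrightarrow>
            bij_betw (\<lambda>act. \<lambda>x\<in>carrier M. act (URB_Q K R P lam) x)
              (URB_structures K R P lam M) (RB_structures K R P lam M)) \<and>
         category_isomorphism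
           (module_category (URB K R P lam) :: ((('k, 'r) free_RB set, 'm) module, 'm \<Rightarrow> 'm) category_data)
           (RB_module_category K R P lam :: (('r, 'm) module \<times> ('m \<Rightarrow> 'm), 'm \<Rightarrow> 'm) category_data)
           (URB_restrict K R P lam) (\<lambda>_ _ f. f)"
proof -
  interpret rota_baxter_algebra K R P lam by fact
  show ?thesis
    using bij_betw_structures category_isomorphism_URB_restrict by blast
qed

end
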